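(* For every integer $n\geq 1$, the graph $G(L(\overline{\Pi}_n))$ has a Hamiltonian cycle, where $\overline{\Pi}_n$ is the $B$-permutahedron.
   Context: The $B$-permutahedron $\overline{\Pi}_n$ is the convex hull of all signed permutations, i.e., of $\{(\pm\pi(1),\ldots,\pm\pi(n)) : \pi\in S_n\}$ (all sign choices); it is $n$-dimensional. For a polytope $P$, $L(P)$ is the inclusion order of all faces of $P$ (including $\emptyset$, of dimension $-1$, and $P$), and $G(L(P))$ is its cover graph, with an edge between faces $F\subset F'$ whenever $\dim F'=\dim F+1$. *)

theory Defs
  imports "HOL-Analysis.Analysis" "Graph_Theory.Graph_Theory"
begin

text \<open>
  The finite type \<open>'n\<close> indexes the coordinates, so \<open>n = CARD('n) \<ge> 1\<close> is arbitrary.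
  Permutations are bijections from the coordinates onto \<open>{1..n}\<close>, which avoids fixing an
  enumeration of \<open>'n\<close>.
\<close>

definition signed_permutation_points :: "(real ^ 'n) set" where
  "signed_permutation_points =
     {\<chi> i. \<sigma> i * real (\<pi> i) |\<sigma> \<pi>.
        bij_betw \<pi> (UNIV :: 'n set) {1..CARD('n)} \<and> (\<forall>i. \<sigma> i = 1 \<or> \<sigma> i = - 1)}"

definition B_permutahedron :: "(real ^ 'n) set" where
  "B_permutahedron = convex hull signed_permutation_points"

text \<open>
  \<^const>\<open>face_of\<close> counts the empty set (\<^const>\<open>aff_dim\<close> equal to \<open>-1\<close>) and \<open>P\<close> itself as faces.
  Undirected graphs are represented, as in \<^locale>\<open>pair_graph\<close>, by symmetric arc relations.
\<close>

definition face_lattice :: "'a::euclidean_space set \<Rightarrow> 'a set set" where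
  "face_lattice P = {F. F face_of P}"

definition face_covers :: "'a::euclidean_space set \<Rightarrow> 'a set rel" where
  "face_covers P = {(F, F'). F \<in> face_lattice P \<and> F' \<in> face_lattice P \<and>
     F \<subset> F' \<and> aff_dim F' = aff_dim F + 1}"

definition face_cover_graph :: "'a::euclidean_space set \<Rightarrow> 'a set pair_pre_digraph" where
  "face_cover_graph P =
     \<lparr>pverts = face_lattice P, parcs = face_covers P \<union> (face_covers P)\<inverse>\<rparr>"

text \<open>
  In a symmetric digraph \<^const>\<open>pre_digraph.cycle\<close> also holds of the walk going back and forth along
  one edge, hence the explicit bound on the length.
\<close>

definition hamiltonian_cycle :: "'a pair_pre_digraph \<Rightarrow> ('a \<times> 'a) list \<Rightarrow> bool" where
  "hamiltonian_cycle G p \<longleftrightarrow>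
     pre_digraph.cycle (with_proj G) p \<and> 3 \<le> length p \<and> fst ` set p = pverts G"

lemma finite_signed_permutation_points: "finite (signed_permutation_points :: (real ^ 'n) set)"
proof (rule finite_subset)
  let ?E = "{- real CARD('n)..real CARD('n)} \<inter> \<int>"
  show "(signed_permutation_points :: (real ^ 'n) set) \<subseteq> vec_lambda ` (UNIV \<rightarrow>\<^sub>E ?E)"
  proof
    fix x :: "real ^ 'n"
    assume "x \<in> signed_permutation_points"
    then obtain \<sigma> \<pi> where x: "x = (\<chi> i. \<sigma> i * real (\<pi> i))"
      and \<pi>: "bij_betw \<pi> (UNIV :: 'n set) {1..CARD('n)}"
      and \<sigma>: "\<forall>i. \<sigma> i = 1 \<or> \<sigma> i = - 1"
      unfolding signed_permutation_points_def by blast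
    have "\<sigma> i * real (\<pi> i) \<in> ?E" for i
    proof -
      have "\<pi> i \<le> CARD('n)"
        using bij_betwE[OF \<pi>] by auto
      then show ?thesis
        using spec[OF \<sigma>, of i] by auto
    qed
    then show "x \<in> vec_lambda ` (UNIV \<rightarrow>\<^sub>E ?E)"
      unfolding x by (intro imageI) auto
  qed
  have "finite ?E"
    by (rule finite_subset[OF _ finite_int_segment[of "- real CARD('n)" "real CARD('n)"]]) auto
  then show "finite (vec_lambda ` (UNIV \<rightarrow>\<^sub>E ?E) :: (real ^ 'n) set)"
    by (intro finite_imageI finite_PiE) auto
qed

lemma polytope_B_permutahedron: "polytope B_permutahedron"
  unfolding polytope_def B_permutahedron_def
  using finite_signed_permutation_points by blast

lemma pair_graph_face_cover_graph:
  assumes "polytope P"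
  shows "pair_graph (face_cover_graph P)"
proof -
  have fin: "finite (face_lattice P)"
    using finite_polytope_faces[OF assms] by (simp add: face_lattice_def)
  have sub: "face_covers P \<union> (face_covers P)\<inverse> \<subseteq> face_lattice P \<times> face_lattice P"
    by (auto simp: face_covers_def)
  have "finite (face_covers P \<union> (face_covers P)\<inverse>)"
    using finite_subset[OF sub] fin by blast
  moreover have "sym (face_covers P \<union> (face_covers P)\<inverse>)"
    by (rule sym_Un_converse)
  ultimately show ?thesis
    using fin sub
    by unfold_locales (auto simp: face_cover_graph_def symmetric_def face_covers_def)
qed

end

theory Submission
  imports Defs
begin

text \<open>
  A nonempty face of the B-permutahedron consists of the points maximizing a linear functional
  \<open>c\<close>, and it depends only on the signs of the \<open>c i\<close> and the weak order of the \<open>\<bar>c i\<bar>\<close>. These data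
  are encoded by an integer vector \<open>f\<close> whose absolute values fill an interval \<open>{0..k}\<close> or \<open>{1..k}\<close>,
  that is, by an ordered partition into \<open>k\<close> signed blocks and a possibly empty zero block; the face
  has dimension \<open>n - k\<close>, and covers amount to merging two neighbouring blocks.

  A new coordinate can be inserted into an ordered signed partition with \<open>k\<close> blocks at \<open>4 k + 3\<close>
  places: into a block with either sign, into the zero block, or as a new singleton block. Read from
  the most negative to the most positive place, these insertions form a path in the cover graph.
  If \<open>f\<close> and \<open>g\<close> are adjacent, then so are the corresponding end points of their paths. Hence a
  Hamiltonian path on \<open>n\<close> coordinates yields one on \<open>n + 1\<close> coordinates by traversing the insertion
  paths in alternating directions, and its two ends are again vertices of the polytope. The empty
  face closes the path to a cycle.
\<close>

subsection \<open>Signed rankings\<close>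

definition signed_ranking :: "int \<Rightarrow> ('a \<Rightarrow> int) \<Rightarrow> bool" where
  "signed_ranking k f \<longleftrightarrow> 0 \<le> k \<and> (\<forall>i. \<bar>f i\<bar> \<le> k) \<and> (\<forall>x. 1 \<le> x \<and> x \<le> k \<longrightarrow> (\<exists>i. \<bar>f i\<bar> = x))"

text \<open>This relation turns out to be inclusion of faces. The two codomains let it also compare
  a vertex of the polytope, a real vector, with an integer ranking.\<close>

definition refines :: "('a \<Rightarrow> 'b::linordered_idom) \<Rightarrow> ('a \<Rightarrow> 'c::linordered_idom) \<Rightarrow> bool" where
  "refines f g \<longleftrightarrow> (\<forall>i. (0 < g i \<longrightarrow> 0 < f i) \<and> (g i < 0 \<longrightarrow> f i < 0)) \<and>
     (\<forall>i j. \<bar>g i\<bar> < \<bar>g j\<bar> \<longrightarrow> \<bar>f i\<bar> < \<bar>f j\<bar>)"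

text \<open>As the levels differ by one, \<open>f\<close> arises from \<open>g\<close> by splitting
  a single block, possibly the zero block, whose remaining zero part may be empty.\<close>

definition split_cover :: "('a \<Rightarrow> int) \<Rightarrow> ('a \<Rightarrow> int) \<Rightarrow> bool" where
  "split_cover f g \<longleftrightarrow> refines f g \<and> (\<exists>k. signed_ranking (k + 1) f \<and> signed_ranking k g)"

definition ranking_adj :: "('a \<Rightarrow> int) \<Rightarrow> ('a \<Rightarrow> int) \<Rightarrow> bool" where
  "ranking_adj f g \<longleftrightarrow> split_cover f g \<or> split_cover g f"

lemma ranking_adj_sym: "ranking_adj f g \<longleftrightarrow> ranking_adj g f"
  by (auto simp: ranking_adj_def)

text \<open>Here \<open>m\<close> becomes a singleton block of signed rank \<open>v\<close>; adding
  \<open>sgn (f i)\<close> moves the blocks from rank \<open>\<bar>v\<bar>\<close> on one step away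
  from zero. Intended for nonzero \<open>v\<close>.\<close>

definition insert_new :: "('a \<Rightarrow> int) \<Rightarrow> 'a \<Rightarrow> int \<Rightarrow> 'a \<Rightarrow> int" where
  "insert_new f m v = (\<lambda>i. if \<bar>f i\<bar> \<ge> \<bar>v\<bar> then f i + sgn (f i) else f i)(m := v)"

text \<open>The top rank, unless it is zero, is attained, so each of the two levels bounds the
  other.\<close>

lemma signed_ranking_unique:
  assumes "signed_ranking k f" "signed_ranking l f"
  shows "k = l"
proof -
  have "k \<le> l" if kl: "signed_ranking k f" "signed_ranking l f" for k l
  proof (cases "k = 0")
    case False
    then have "1 \<le> k \<and> k \<le> k" using kl(1) by (auto simp: signed_ranking_def)
    then obtain i where "\<bar>f i\<bar> = k" using kl(1) unfolding signed_ranking_def by blast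
    then show ?thesis using kl(2) unfolding signed_ranking_def by metis
  qed (use kl in \<open>simp add: signed_ranking_def\<close>)
  then show ?thesis using assms by (meson order_antisym)
qed

text \<open>Overwriting the value zero loses no positive rank.\<close>

lemma signed_ranking_upd:
  assumes "signed_ranking k f" "f m = 0" "\<bar>v\<bar> \<le> k"
  shows "signed_ranking k (f(m := v))"
  using assms unfolding signed_ranking_def
  by (metis abs_zero fun_upd_apply not_one_le_zero)

lemma signed_ranking_upd_top:
  assumes "signed_ranking k f" "f m = 0" "\<bar>v\<bar> = k + 1"
  shows "signed_ranking (k + 1) (f(m := v))"
  unfolding signed_ranking_def
proof (intro conjI allI impI)
  show "0 \<le> k + 1" using assms by (simp add: signed_ranking_def)
  show "\<bar>(f(m := v)) i\<bar> \<le> k + 1" for i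
    using assms by (simp add: signed_ranking_def add_increasing2)
  fix x assume x: "1 \<le> x \<and> x \<le> k + 1"
  show "\<exists>i. \<bar>(f(m := v)) i\<bar> = x"
  proof (cases "x = k + 1")
    case False
    then have "1 \<le> x \<and> x \<le> k" using x by linarith
    then obtain i where "\<bar>f i\<bar> = x" using assms(1) unfolding signed_ranking_def by blast
    then show ?thesis using x assms(2) by (intro exI[of _ i]) auto
  qed (use assms in \<open>auto intro: exI[of _ m]\<close>)
qed

lemma insert_new_top:
  assumes "signed_ranking k f" "\<bar>v\<bar> = k + 1"
  shows "insert_new f m v = f(m := v)"
proof -
  have "\<not> \<bar>v\<bar> \<le> \<bar>f i\<bar>" for i using assms unfolding signed_ranking_def by smt
  then show ?thesis by (simp add: insert_new_def)
qed

section \<open>Inserting a coordinate as a singleton block\<close>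

lemma abs_add_sgn: "v \<noteq> 0 \<Longrightarrow> \<bar>v + sgn v\<bar> = \<bar>v\<bar> + 1" for v :: int
  by (auto simp: sgn_if)

lemma abs_diff_sgn: "v \<noteq> 0 \<Longrightarrow> \<bar>v - sgn v\<bar> = \<bar>v\<bar> - 1" for v :: int
  by (auto simp: sgn_if)

lemma insert_new_same [simp]: "insert_new f m v m = v"
  by (simp add: insert_new_def)

lemma abs_insert_new:
  assumes "i \<noteq> m" "v \<noteq> 0"
  shows "\<bar>insert_new f m v i\<bar> = (if \<bar>v\<bar> \<le> \<bar>f i\<bar> then \<bar>f i\<bar> + 1 else \<bar>f i\<bar>)"
proof (cases "f i = 0")
  case False
  then show ?thesis using assms by (simp add: insert_new_def abs_add_sgn)
qed (use assms in \<open>simp add: insert_new_def\<close>)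

lemma sgn_insert_new: "i \<noteq> m \<Longrightarrow> sgn (insert_new f m v i) = sgn (f i)"
  by (simp add: insert_new_def sgn_if)

text \<open>Ranks below \<open>\<bar>v\<bar>\<close> keep their witnesses, rank
  \<open>\<bar>v\<bar>\<close> is taken by \<open>m\<close>, and larger ranks come from witnesses
  one rank lower.\<close>

lemma signed_ranking_insert_new:
  assumes f: "signed_ranking k f" "f m = 0" and v: "v \<noteq> 0" "\<bar>v\<bar> \<le> k + 1"
  shows "signed_ranking (k + 1) (insert_new f m v)"
  unfolding signed_ranking_def
proof (intro conjI allI impI)
  show "0 \<le> k + 1" using assms by (simp add: signed_ranking_def)
  show "\<bar>insert_new f m v i\<bar> \<le> k + 1" for i
  proof (cases "i = m")
    case False
    have "\<bar>f i\<bar> \<le> k" using f by (simp add: signed_ranking_def)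
    then show ?thesis by (simp add: abs_insert_new[OF False v(1)])
  qed (simp add: v)
  fix x assume x: "1 \<le> x \<and> x \<le> k + 1"
  have *: "i \<noteq> m" if "\<bar>f i\<bar> = y" "1 \<le> y" for i y
    using that f(2) by auto
  consider "x < \<bar>v\<bar>" | "x = \<bar>v\<bar>" | "x > \<bar>v\<bar>" by linarith
  then show "\<exists>i. \<bar>insert_new f m v i\<bar> = x"
  proof cases
    case 1
    then have x': "1 \<le> x \<and> x \<le> k" using x v by linarith
    then obtain i where i: "\<bar>f i\<bar> = x" using f unfolding signed_ranking_def by blast
    then show ?thesis
      using abs_insert_new[OF *[OF i] v(1), of f] x' 1 by (intro exI[of _ i]) simp
  next
    case 2
    then show ?thesis by (intro exI[of _ m]) simp
  next
    case 3
    then have x': "1 \<le> x - 1 \<and> x - 1 \<le> k" using x v by linarith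
    then obtain i where i: "\<bar>f i\<bar> = x - 1" using f unfolding signed_ranking_def by blast
    then show ?thesis
      using abs_insert_new[OF *[OF i] v(1), of f] x' 3 by (intro exI[of _ i]) simp
  qed
qed

lemma refinesI_sgn:
  fixes f g :: "'a \<Rightarrow> int"
  assumes "\<And>i. g i \<noteq> 0 \<Longrightarrow> sgn (f i) = sgn (g i)"
    and "\<And>i j. \<bar>g i\<bar> < \<bar>g j\<bar> \<Longrightarrow> \<bar>f i\<bar> < \<bar>f j\<bar>"
  shows "refines f g"
  using assms(2) unfolding refines_def by (metis assms(1) order_less_irrefl sgn_greater sgn_less)

text \<open>The shift preserves all strict inequalities and only breaks ties with \<open>m\<close>,
  leaving \<open>m\<close> on the inner side.\<close>

lemma refines_insert_new_upd:
  assumes "v \<noteq> 0"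
  shows "refines (insert_new f m v) (f(m := v))"
proof (rule refinesI_sgn)
  fix i j
  show "sgn (insert_new f m v i) = sgn ((f(m := v)) i)"
    by (cases "i = m") (auto simp: sgn_insert_new)
  show "\<bar>insert_new f m v i\<bar> < \<bar>insert_new f m v j\<bar>" if "\<bar>(f(m := v)) i\<bar> < \<bar>(f(m := v)) j\<bar>"
    using that abs_insert_new[OF _ assms, of i m f] abs_insert_new[OF _ assms, of j m f]
    by (cases "i = m"; cases "j = m") (simp_all split: if_splits)
qed

text \<open>Now \<open>m\<close> is tied with the block just inside rank \<open>v\<close>, and the
  insertion leaves it on the outer side. For \<open>v\<close> equal to 1 or -1 that block is the
  zero block, where \<open>m\<close> has no sign to preserve.\<close>

lemma refines_insert_new_upd_pred:
  assumes "v \<noteq> 0"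
  shows "refines (insert_new f m v) (f(m := v - sgn v))"
proof (rule refinesI_sgn)
  fix i j
  show "sgn (insert_new f m v i) = sgn ((f(m := v - sgn v)) i)" if "(f(m := v - sgn v)) i \<noteq> 0"
  proof (cases "i = m")
    case True
    then show ?thesis using that by (auto simp: sgn_if split: if_splits)
  qed (simp add: sgn_insert_new)
  show "\<bar>insert_new f m v i\<bar> < \<bar>insert_new f m v j\<bar>"
    if "\<bar>(f(m := v - sgn v)) i\<bar> < \<bar>(f(m := v - sgn v)) j\<bar>"
    using that abs_insert_new[OF _ assms, of i m f] abs_insert_new[OF _ assms, of j m f]
      abs_diff_sgn[OF assms]
    by (cases "i = m"; cases "j = m") (simp_all split: if_splits)
qed

text \<open>The singleton is merged with its outer neighbour, which exists because
  \<open>\<bar>v\<bar> \<le> k\<close>. The companion lemma merges it inwards, which also works for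
  the outermost singleton.\<close>

lemma split_cover_insert_new:
  assumes "signed_ranking k f" "f m = 0" "v \<noteq> 0" "\<bar>v\<bar> \<le> k"
  shows "split_cover (insert_new f m v) (f(m := v))"
  using signed_ranking_insert_new[OF assms(1-3)] signed_ranking_upd[OF assms(1,2,4)]
    refines_insert_new_upd[OF assms(3)] assms(4)
  by (auto simp: split_cover_def)

lemma split_cover_insert_new_pred:
  assumes "signed_ranking k f" "f m = 0" "v \<noteq> 0" "\<bar>v\<bar> \<le> k + 1"
  shows "split_cover (insert_new f m v) (f(m := v - sgn v))"
  using signed_ranking_insert_new[OF assms] signed_ranking_upd[OF assms(1,2), of "v - sgn v"]
    refines_insert_new_upd_pred[OF assms(3)] assms(3,4)
  by (auto simp: split_cover_def abs_diff_sgn)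

text \<open>An outermost singleton of the same sign on both sides does not interfere with the split
  below it. This links the rows of neighbouring rankings.\<close>

lemma split_cover_upd_top:
  assumes "refines f g" and f: "signed_ranking (k + 1) f" "f m = 0"
    and g: "signed_ranking k g" "g m = 0" and s: "\<bar>s\<bar> = 1"
  shows "split_cover (f(m := s * (k + 2))) (g(m := s * (k + 1)))"
proof -
  have k: "0 \<le> k" using g by (simp add: signed_ranking_def)
  then have top: "\<bar>s * (k + 2)\<bar> = k + 2" "\<bar>s * (k + 1)\<bar> = k + 1"
    using s by (simp_all only: abs_mult) simp_all
  have sgn: "0 < s * (k + 2) \<longleftrightarrow> 0 < s * (k + 1)" "s * (k + 2) < 0 \<longleftrightarrow> s * (k + 1) < 0"
    using k by (auto simp: zero_less_mult_iff mult_less_0_iff)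
  have "signed_ranking (k + 1 + 1) (f(m := s * (k + 2)))"
    using top by (intro signed_ranking_upd_top[OF f]) simp
  moreover have "signed_ranking (k + 1) (g(m := s * (k + 1)))"
    by (rule signed_ranking_upd_top[OF g top(2)])
  moreover have "refines (f(m := s * (k + 2))) (g(m := s * (k + 1)))"
  proof -
    have le: "\<bar>f i\<bar> \<le> k + 1" "\<bar>g i\<bar> \<le> k" for i
      using f(1) g(1) by (simp_all add: signed_ranking_def)
    have "\<bar>f i\<bar> < k + 2 \<and> \<not> k + 1 < \<bar>g i\<bar>" for i
      using le[of i] by linarith
    then show ?thesis using assms(1) sgn
      by (simp add: refines_def top)
  qed
  ultimately show ?thesis unfolding split_cover_def by blast
qed

text \<open>Places are numbered along a line: \<open>2 * v\<close> joins the signed block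
  \<open>v\<close> (the zero block for \<open>v = 0\<close>), and the odd numbers are the gaps.
  Adding \<open>sgn t\<close> before halving rounds away from zero, so the gap just inside place
  \<open>2 * v\<close> creates the singleton \<open>v\<close>.\<close>

definition insert_at :: "('a \<Rightarrow> int) \<Rightarrow> 'a \<Rightarrow> int \<Rightarrow> 'a \<Rightarrow> int" where
  "insert_at f m t = (if even t then f(m := t div 2) else insert_new f m ((t + sgn t) div 2))"

text \<open>Of two consecutive places one is a gap. Parity tells which one, and the sign tells
  whether the block at the other place lies inside or outside the gap; each of the four cases is one
  of the two insertion covers.\<close>

lemma insert_at_adj:
  assumes f: "signed_ranking k f" "f m = 0" and t: "-(2*k+1) \<le> t" "t < 2*k+1"
  shows "ranking_adj (insert_at f m t) (insert_at f m (t + 1))"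
proof (cases "even t")
  case True
  then obtain v where v: "t = 2 * v" by blast
  show ?thesis
  proof (cases "v \<ge> 0")
    case True
    then have "insert_at f m (t + 1) = insert_new f m (v + 1)"
      by (simp add: insert_at_def v sgn_if add.commute)
    moreover have "insert_at f m t = f(m := (v + 1) - sgn (v + 1))"
      using True by (simp add: insert_at_def v)
    ultimately show ?thesis
      using split_cover_insert_new_pred[OF f, of "v + 1"] v True t by (simp add: ranking_adj_def)
  next
    case False
    then have "insert_at f m (t + 1) = insert_new f m v"
      by (simp add: insert_at_def v sgn_if)
    moreover have "insert_at f m t = f(m := v)" by (simp add: insert_at_def v)
    ultimately show ?thesis
      using split_cover_insert_new[OF f, of v] v False t by (simp add: ranking_adj_def)
  qed
next
  case False
  then obtain w where w: "t = 2 * w + 1" by (elim oddE)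
  \<comment> \<open>Chosen so that the place after the gap \<open>t\<close> is block
    \<open>v\<close>.\<close>
  define v where "v = w + 1"
  have v: "t = 2 * v - 1" using w by (simp add: v_def)
  have *: "insert_at f m (t + 1) = f(m := v)" by (simp add: insert_at_def v)
  show ?thesis
  proof (cases "v > 0")
    case True
    then have "insert_at f m t = insert_new f m v"
      by (simp add: insert_at_def v sgn_if)
    then show ?thesis
      using split_cover_insert_new[OF f, of v] v True t * by (simp add: ranking_adj_def)
  next
    case False
    then have "insert_at f m t = insert_new f m (v - 1)"
      by (auto simp: insert_at_def v sgn_if)
    moreover have "f(m := v) = f(m := (v - 1) - sgn (v - 1))"
      using False by simp
    ultimately show ?thesis
      using split_cover_insert_new_pred[OF f, of "v - 1"] v False t *
      by (simp add: ranking_adj_def)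
  qed
qed

text \<open>The two extreme places make \<open>m\<close> the outermost block, where the insertion
  shifts nothing.\<close>

lemma insert_at_top:
  assumes "signed_ranking k f" "\<bar>s\<bar> = 1"
  shows "insert_at f m (s * (2 * k + 1)) = f(m := s * (k + 1))"
proof -
  have "0 \<le> k" using assms by (simp add: signed_ranking_def)
  moreover have "s = 1 \<or> s = -1" using assms(2) by linarith
  moreover have "(- 1 - 2 * k - 1) div 2 = - 1 - k" by presburger
  moreover have "sgn (- 1 - 2 * k) = -1" using calculation by (simp add: sgn_if)
  ultimately have "(s * (2 * k + 1) + sgn (s * (2 * k + 1))) div 2 = s * (k + 1)"
    by (auto simp: sgn_if)
  moreover have "odd (s * (2 * k + 1))" using \<open>s = 1 \<or> s = -1\<close> by auto
  moreover have "\<bar>s * (k + 1)\<bar> = k + 1" using assms \<open>0 \<le> k\<close> by (simp add: abs_mult)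
  ultimately show ?thesis
    using insert_new_top[OF assms(1)] by (simp add: insert_at_def)
qed

subsection \<open>A Hamiltonian path of signed rankings\<close>

definition ranking_level :: "('a \<Rightarrow> int) \<Rightarrow> int" where
  "ranking_level f = (THE k. signed_ranking k f)"

lemma ranking_level_eq: "signed_ranking k f \<Longrightarrow> ranking_level f = k"
  unfolding ranking_level_def using signed_ranking_unique by blast

text \<open>Coordinates outside \<open>S\<close> are parked in the zero block, so that the induction
  on the number of coordinates stays within one type.\<close>

definition rankings_on :: "'a set \<Rightarrow> ('a \<Rightarrow> int) set" where
  "rankings_on S = {f. (\<exists>k. signed_ranking k f) \<and> (\<forall>i. i \<notin> S \<longrightarrow> f i = 0)}"

lemma insert_at_even: "insert_at f m (2 * v) = f(m := v)"
  by (simp add: insert_at_def)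

lemma insert_at_odd: "v \<noteq> 0 \<Longrightarrow> insert_at f m (2 * v - sgn v) = insert_new f m v"
  by (auto simp: insert_at_def sgn_if)

definition slots :: "int \<Rightarrow> int set" where
  "slots k = {-(2 * k + 1)..2 * k + 1}"

text \<open>A division-free normal form of the places, in which \<open>v\<close> is the value that
  \<open>m\<close> receives.\<close>

lemma slots_cases:
  assumes "t \<in> slots k"
  obtains (even) v where "t = 2 * v" "\<bar>v\<bar> \<le> k"
  | (odd) v where "v \<noteq> 0" "t = 2 * v - sgn v" "\<bar>v\<bar> \<le> k + 1"
proof (cases "even t")
  case True
  then obtain v where "t = 2 * v" by blast
  with assms show ?thesis by (intro even[of v]) (auto simp: slots_def)
next
  case False
  then obtain w where w: "t = 2 * w + 1" by (elim oddE)
  \<comment> \<open>Rounding away from zero: \<open>2 * w + 1\<close> is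
    \<open>2 * (w + 1) - 1\<close> for nonnegative \<open>w\<close>, but \<open>2 * w - (-1)\<close>
    for negative \<open>w\<close>.\<close>
  show ?thesis
  proof (cases "w \<ge> 0")
    case True
    with assms w show ?thesis by (intro odd[of "w + 1"]) (auto simp: slots_def)
  next
    case False
    with assms w show ?thesis by (intro odd[of w]) (auto simp: slots_def)
  qed
qed

section \<open>Every ranking arises from exactly one insertion\<close>

lemma insert_at_in_rankings_on:
  assumes f: "signed_ranking k f" "f \<in> rankings_on S" and m: "m \<notin> S" and t: "t \<in> slots k"
  shows "insert_at f m t \<in> rankings_on (insert m S)"
proof -
  have fm: "f i = 0" if "i \<notin> S" for i using f m that by (simp add: rankings_on_def)
  note fm' = fm[OF m]
  from t show ?thesis
  proof (cases rule: slots_cases)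
    case (even v)
    then show ?thesis
      using signed_ranking_upd[OF f(1), OF fm', OF even(2)] fm
      by (auto simp: rankings_on_def insert_at_even)
  next
    case (odd v)
    then show ?thesis
      using signed_ranking_insert_new[OF f(1), OF fm', OF odd(1,3)] fm
      by (auto simp: rankings_on_def insert_at_odd insert_new_def)
  qed
qed

text \<open>The shift of the absolute values skips \<open>\<bar>v\<bar>\<close> and is injective,
  and signs survive it.\<close>

lemma insert_new_inj:
  assumes fg: "f m = 0" "g m = 0" and v: "v \<noteq> 0" and eq: "insert_new f m v = insert_new g m v"
  shows "f = g"
proof
  fix i
  show "f i = g i"
  proof (cases "i = m")
    case False
    have "\<bar>f i\<bar> = \<bar>g i\<bar>"
      using abs_insert_new[OF False v, of f] abs_insert_new[OF False v, of g] eq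
      by (simp split: if_splits)
    moreover have "sgn (f i) = sgn (g i)"
      using sgn_insert_new[OF False] eq by metis
    ultimately show ?thesis by (metis sgn_mult_abs)
  qed (simp add: fg)
qed

text \<open>On the left \<open>m\<close> shares its rank with another coordinate; on the right it is
  alone.\<close>

lemma upd_neq_insert_new:
  assumes f: "signed_ranking k f" "f m = 0" and v: "v \<noteq> 0" "\<bar>v\<bar> \<le> k"
  shows "f(m := v) \<noteq> insert_new g m w"
proof
  assume eq: "f(m := v) = insert_new g m w"
  then have w: "w = v" by (metis fun_upd_same insert_new_same)
  have "1 \<le> \<bar>v\<bar> \<and> \<bar>v\<bar> \<le> k" using v by linarith
  then obtain i where i: "\<bar>f i\<bar> = \<bar>v\<bar>" using f unfolding signed_ranking_def by blast
  with f v have "i \<noteq> m" by auto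
  with eq have "insert_new g m w i = f i" by (metis fun_upd_other)
  with abs_insert_new[OF \<open>i \<noteq> m\<close> v(1), of g] i w show False by (simp split: if_splits)
qed

text \<open>The value at \<open>m\<close> reveals \<open>v\<close>, and whether \<open>m\<close> is
  alone at a nonzero rank reveals the parity of the place.\<close>

lemma insert_at_inj:
  assumes f: "signed_ranking k f" "f m = 0" "t \<in> slots k"
    and g: "signed_ranking l g" "g m = 0" "u \<in> slots l"
    and eq: "insert_at f m t = insert_at g m u"
  shows "f = g \<and> t = u"
proof -
  have upd: "f = g" if "f(m := v) = g(m := v)" for v
    using that f(2) g(2) by (metis fun_upd_triv fun_upd_upd)
  from f(3) show ?thesis
  proof (cases rule: slots_cases)
    case t: (even v)
    from g(3) show ?thesis
    proof (cases rule: slots_cases)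
      case u: (even w)
      then have *: "f(m := v) = g(m := w)" using eq t by (simp add: insert_at_even)
      then have "v = w" by (metis fun_upd_same)
      with * upd t u show ?thesis by simp
    next
      case u: (odd w)
      then have *: "f(m := v) = insert_new g m w"
        using eq t by (simp add: insert_at_even insert_at_odd)
      then have "v = w" by (metis fun_upd_same insert_new_same)
      with * upd_neq_insert_new[OF f(1,2) _ t(2)] u show ?thesis by metis
    qed
  next
    case t: (odd v)
    from g(3) show ?thesis
    proof (cases rule: slots_cases)
      case u: (even w)
      then have *: "g(m := w) = insert_new f m v"
        using eq t by (simp add: insert_at_even insert_at_odd)
      then have "v = w" by (metis fun_upd_same insert_new_same)
      with * upd_neq_insert_new[OF g(1,2) _ u(2)] t show ?thesis by metis
    next
      case u: (odd w)
      then have *: "insert_new f m v = insert_new g m w" using eq t by (simp add: insert_at_odd)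
      then have "v = w" by (metis insert_new_same)
      with * insert_new_inj[of f m g v, OF f(2) g(2) t(1)] t u show ?thesis by simp
    qed
  qed
qed

text \<open>Undoes \<open>insert_new\<close> when \<open>m\<close> is a block of its own: the gap it
  leaves is closed.\<close>

definition remove_ranked :: "'a \<Rightarrow> ('a \<Rightarrow> int) \<Rightarrow> 'a \<Rightarrow> int" where
  "remove_ranked m h = (\<lambda>i. if \<bar>h m\<bar> < \<bar>h i\<bar> then h i - sgn (h i) else h i)(m := 0)"

lemma insert_new_remove_ranked:
  assumes "h m \<noteq> 0" "\<And>i. i \<noteq> m \<Longrightarrow> \<bar>h i\<bar> \<noteq> \<bar>h m\<bar>"
  shows "insert_new (remove_ranked m h) m (h m) = h"
proof
  fix i
  show "insert_new (remove_ranked m h) m (h m) i = h i"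
  proof (cases "i = m")
    case False
    then show ?thesis using assms(1) assms(2)[OF False]
      by (auto simp: insert_new_def remove_ranked_def sgn_if)
  qed simp
qed

lemma signed_ranking_remove_ranked:
  assumes h: "signed_ranking k h" "h m \<noteq> 0" "\<And>i. i \<noteq> m \<Longrightarrow> \<bar>h i\<bar> \<noteq> \<bar>h m\<bar>"
  shows "signed_ranking (k - 1) (remove_ranked m h)"
  unfolding signed_ranking_def
proof (intro conjI allI impI)
  have le: "\<bar>h i\<bar> \<le> k" for i using h(1) by (simp add: signed_ranking_def)
  show k: "0 \<le> k - 1" using le[of m] h(2) by linarith
  have abs: "\<bar>remove_ranked m h i\<bar> = (if \<bar>h m\<bar> < \<bar>h i\<bar> then \<bar>h i\<bar> - 1 else \<bar>h i\<bar>)"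
    if "i \<noteq> m" for i
    using that abs_diff_sgn[of "h i"] by (auto simp: remove_ranked_def)
  show "\<bar>remove_ranked m h i\<bar> \<le> k - 1" for i
  proof (cases "i = m")
    case True
    then show ?thesis using k by (simp add: remove_ranked_def)
  next
    case False
    then show ?thesis using abs[OF False] h(3)[OF False] le[of i] le[of m] by (simp split: if_splits)
  qed
  fix x assume x: "1 \<le> x \<and> x \<le> k - 1"
  \<comment> \<open>The rank in \<open>h\<close> that becomes \<open>x\<close> once the gap is
    closed; it avoids \<open>\<bar>h m\<bar>\<close>, so its witness is not
    \<open>m\<close>.\<close>
  define y where "y = (if x < \<bar>h m\<bar> then x else x + 1)"
  have "1 \<le> y \<and> y \<le> k" using x by (simp add: y_def)
  then obtain i where i: "\<bar>h i\<bar> = y" using h(1) unfolding signed_ranking_def by blast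
  then have "i \<noteq> m" by (auto simp: y_def split: if_splits)
  with i abs have "\<bar>remove_ranked m h i\<bar> = x" by (auto simp: y_def split: if_splits)
  then show "\<exists>i. \<bar>remove_ranked m h i\<bar> = x" by blast
qed

text \<open>If \<open>m\<close> lies in the zero block or shares its rank, erasing its value keeps a
  ranking of the same level and the place is even. Otherwise its block is removed, the level drops
  by one and the place is a gap.\<close>

lemma insert_at_surj:
  assumes "h \<in> rankings_on (insert m S)" "m \<notin> S"
  obtains k f t where "signed_ranking k f" "f \<in> rankings_on S" "t \<in> slots k" "h = insert_at f m t"
proof -
  from assms obtain k where k: "signed_ranking k h" by (auto simp: rankings_on_def)
  have zero: "h i = 0" if "i \<notin> insert m S" for i using assms that by (simp add: rankings_on_def)
  have le: "\<bar>h i\<bar> \<le> k" for i using k by (simp add: signed_ranking_def)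
  show ?thesis
  proof (cases "h m = 0 \<or> (\<exists>i. i \<noteq> m \<and> \<bar>h i\<bar> = \<bar>h m\<bar>)")
    case True
    have "\<exists>i. \<bar>(h(m := 0)) i\<bar> = x" if x: "1 \<le> x \<and> x \<le> k" for x
    proof -
      obtain i where i: "\<bar>h i\<bar> = x" using k x unfolding signed_ranking_def by blast
      show ?thesis
      proof (cases "i = m")
        case False
        with i show ?thesis by (intro exI[of _ i]) simp
      next
        case m: True
        \<comment> \<open>Another coordinate of the same rank as \<open>m\<close> takes over as
          witness.\<close>
        with True i x obtain j where "j \<noteq> m" "\<bar>h j\<bar> = x" by auto
        then show ?thesis by (intro exI[of _ j]) simp
      qed
    qed
    then have 1: "signed_ranking k (h(m := 0))"
      using k by (auto simp: signed_ranking_def)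
    show ?thesis
    proof (rule that)
      show "signed_ranking k (h(m := 0))" by (rule 1)
      show "h(m := 0) \<in> rankings_on S" using 1 zero by (auto simp: rankings_on_def)
      show "2 * h m \<in> slots k" using le[of m] by (auto simp: slots_def)
      show "h = insert_at (h(m := 0)) m (2 * h m)" by (simp add: insert_at_even)
    qed
  next
    case False
    then have hm: "h m \<noteq> 0" and ne: "\<And>i. i \<noteq> m \<Longrightarrow> \<bar>h i\<bar> \<noteq> \<bar>h m\<bar>" by auto
    have 1: "signed_ranking (k - 1) (remove_ranked m h)"
      by (rule signed_ranking_remove_ranked[OF k hm ne])
    show ?thesis
    proof (rule that)
      show "signed_ranking (k - 1) (remove_ranked m h)" by (rule 1)
      show "remove_ranked m h \<in> rankings_on S"
        using 1 zero by (auto simp: rankings_on_def remove_ranked_def)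
      show "2 * h m - sgn (h m) \<in> slots (k - 1)"
        using le[of m] hm by (auto simp: slots_def sgn_if)
      show "h = insert_at (remove_ranked m h) m (2 * h m - sgn (h m))"
        using insert_new_remove_ranked[of h m, OF hm ne] hm by (simp add: insert_at_odd)
    qed
  qed
qed

section \<open>Traversing the insertion paths in alternating directions\<close>

definition insertion_row :: "'a \<Rightarrow> ('a \<Rightarrow> int) \<Rightarrow> bool \<Rightarrow> ('a \<Rightarrow> int) list" where
  "insertion_row m f b = (let k = ranking_level f; r = map (insert_at f m) [-(2 * k + 1)..2 * k + 1]
     in if b then r else rev r)"

text \<open>The flag \<open>b\<close> means upwards, from the most negative place. Alternating it
  makes each row start on the side where the previous one ended.\<close>

fun zigzag :: "'a \<Rightarrow> bool \<Rightarrow> ('a \<Rightarrow> int) list \<Rightarrow> ('a \<Rightarrow> int) list" where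
  "zigzag m b [] = []"
| "zigzag m b (f # fs) = insertion_row m f b @ zigzag m (\<not> b) fs"

lemma set_row: "signed_ranking k f \<Longrightarrow> set (insertion_row m f b) = insert_at f m ` slots k"
  by (simp add: insertion_row_def slots_def ranking_level_eq Let_def)

lemma distinct_row:
  assumes "signed_ranking k f" "f m = 0"
  shows "distinct (insertion_row m f b)"
proof -
  have "inj_on (insert_at f m) (slots k)"
    using insert_at_inj[OF assms _ assms] by (auto intro!: inj_onI)
  then show ?thesis
    using ranking_level_eq[OF assms(1)] by (simp add: insertion_row_def Let_def distinct_map slots_def)
qed

lemma row_adj:
  assumes "signed_ranking k f" "f m = 0"
  shows "successively ranking_adj (insertion_row m f b)"
proof -
  have "0 \<le> k" using assms(1) by (simp add: signed_ranking_def)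
  then have "ranking_adj (insert_at f m (-(2 * k + 1) + int i)) (insert_at f m (-(2 * k + 1) + int (Suc i)))"
    if "Suc i < length [-(2 * k + 1)..2 * k + 1]" for i
    using that insert_at_adj[OF assms, of "-(2 * k + 1) + int i"] by (simp add: algebra_simps)
  then have "successively ranking_adj (map (insert_at f m) [-(2 * k + 1)..2 * k + 1])"
    by (simp add: successively_conv_nth nth_upto)
  then show ?thesis
    by (simp add: insertion_row_def Let_def ranking_level_eq[OF assms(1)] ranking_adj_sym[symmetric])
qed

lemma row_ends:
  assumes "signed_ranking k f"
  shows "insertion_row m f b \<noteq> []"
    and "hd (insertion_row m f b) = f(m := (if b then -1 else 1) * (k + 1))"
    and "last (insertion_row m f b) = f(m := (if b then 1 else -1) * (k + 1))"
proof -
  have k: "0 \<le> k" using assms by (simp add: signed_ranking_def)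
  then show "insertion_row m f b \<noteq> []"
    by (simp add: insertion_row_def Let_def ranking_level_eq[OF assms])
  have "hd [-(2 * k + 1)..2 * k + 1] = -1 * (2 * k + 1)"
    using k by (simp add: upto_rec1)
  moreover have "last [-(2 * k + 1)..2 * k + 1] = 1 * (2 * k + 1)"
    using k by (simp add: upto_rec2)
  ultimately show "hd (insertion_row m f b) = f(m := (if b then -1 else 1) * (k + 1))"
    "last (insertion_row m f b) = f(m := (if b then 1 else -1) * (k + 1))"
    using insert_at_top[OF assms, of "-1" m] insert_at_top[OF assms, of 1 m] k
    by (simp_all add: insertion_row_def Let_def ranking_level_eq[OF assms] hd_map last_map hd_rev last_rev)
qed

text \<open>One row ends and the next one starts with \<open>m\<close> as outermost singleton of the
  same sign \<open>s\<close>, so the adjacency of \<open>f\<close> and \<open>g\<close>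
  lifts.\<close>

lemma row_to_row_adj:
  assumes "ranking_adj f g" "f m = 0" "g m = 0"
  shows "ranking_adj (last (insertion_row m f b)) (hd (insertion_row m g (\<not> b)))"
proof -
  have *: "split_cover (f(m := s * (k + 1))) (g(m := s * (l + 1)))"
    if "split_cover f g" "signed_ranking k f" "signed_ranking l g" "\<bar>s\<bar> = 1" "f m = 0" "g m = 0"
    for f g k l s
  proof -
    from that(1) obtain l' where l': "signed_ranking (l' + 1) f" "signed_ranking l' g" "refines f g"
      unfolding split_cover_def by blast
    \<comment> \<open>Uniqueness of levels identifies the level hidden in \<open>split_cover\<close>
      with the given ones.\<close>
    then have "l' = l" "k = l + 1" using that(2,3) signed_ranking_unique by blast+
    then show ?thesis
      using split_cover_upd_top[OF l'(3) l'(1) that(5) l'(2) that(6,4)] by (simp add: add.assoc)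
  qed
  from assms(1) obtain k l where kl: "signed_ranking k f" "signed_ranking l g"
    unfolding ranking_adj_def split_cover_def by blast
  define s :: int where "s = (if b then 1 else -1)"
  have "\<bar>s\<bar> = 1" by (simp add: s_def)
  then have "ranking_adj (f(m := s * (k + 1))) (g(m := s * (l + 1)))"
    using assms *[OF _ kl] *[OF _ kl(2,1)] by (auto simp: ranking_adj_def)
  then show ?thesis
    by (cases b) (simp_all add: row_ends(3)[OF kl(1)] row_ends(2)[OF kl(2)] s_def)
qed

lemma zigzag_adj:
  assumes "successively ranking_adj fs" "set fs \<subseteq> rankings_on S" "m \<notin> S"
  shows "successively ranking_adj (zigzag m b fs)"
  using assms
proof (induction fs arbitrary: b)
  case (Cons f fs)
  from Cons.prems obtain k where k: "signed_ranking k f" by (auto simp: rankings_on_def)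
  have fm: "f m = 0" using Cons.prems by (auto simp: rankings_on_def)
  have "ranking_adj (last (insertion_row m f b)) (hd (zigzag m (\<not> b) fs))" if "fs \<noteq> []"
  proof -
    from that obtain g gs where fs: "fs = g # gs" by (cases fs) auto
    with Cons.prems have g: "ranking_adj f g" "g m = 0" by (auto simp: rankings_on_def)
    from fs Cons.prems obtain l where "signed_ranking l g" by (auto simp: rankings_on_def)
    then show ?thesis using row_to_row_adj[OF g(1) fm g(2)] fs row_ends(1) by (metis hd_append2 zigzag.simps(2))
  qed
  moreover have "successively ranking_adj fs" using Cons.prems(1) by (cases fs) auto
  ultimately show ?case
    using Cons.IH[of "\<not> b"] Cons.prems row_adj[OF k, OF fm, of b]
    by (cases "fs = []") (simp_all add: successively_append_iff)
qed simp

text \<open>Direction does not affect the members of a row, so the fixed flag \<open>True\<close>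
  serves for all of them.\<close>

lemma set_zigzag:
  "set (zigzag m b fs) = (\<Union>f\<in>set fs. set (insertion_row m f True))"
proof (induction fs arbitrary: b)
  case (Cons f fs)
  have "set (insertion_row m f b) = set (insertion_row m f True)" by (simp add: insertion_row_def Let_def)
  with Cons show ?case by simp
qed simp

lemma set_zigzag_rankings_on:
  assumes "m \<notin> S" "set fs = rankings_on S"
  shows "set (zigzag m b fs) = rankings_on (insert m S)"
proof (intro equalityI subsetI)
  fix h assume "h \<in> set (zigzag m b fs)"
  then obtain f where f: "f \<in> rankings_on S" "h \<in> set (insertion_row m f True)"
    using assms(2) by (auto simp: set_zigzag)
  then obtain k where k: "signed_ranking k f" by (auto simp: rankings_on_def)
  with f insert_at_in_rankings_on[OF k f(1) assms(1)] show "h \<in> rankings_on (insert m S)"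
    by (auto simp: set_row[OF k])
next
  fix h assume "h \<in> rankings_on (insert m S)"
  then obtain k f t where "signed_ranking k f" "f \<in> rankings_on S" "t \<in> slots k" "h = insert_at f m t"
    using insert_at_surj assms(1) by metis
  then show "h \<in> set (zigzag m b fs)"
    using assms(2) set_row by (fastforce simp: set_zigzag)
qed

text \<open>Rows of different rankings are disjoint, since an insertion determines the ranking it
  came from.\<close>

lemma distinct_zigzag:
  assumes "distinct fs" "set fs \<subseteq> rankings_on S" "m \<notin> S"
  shows "distinct (zigzag m b fs)"
  using assms
proof (induction fs arbitrary: b)
  case (Cons f fs)
  from Cons.prems obtain k where k: "signed_ranking k f" by (auto simp: rankings_on_def)
  have fm: "f m = 0" using Cons.prems by (auto simp: rankings_on_def)
  have "set (insertion_row m f b) \<inter> set (zigzag m (\<not> b) fs) = {}"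
  proof (rule ccontr)
    assume "set (insertion_row m f b) \<inter> set (zigzag m (\<not> b) fs) \<noteq> {}"
    then obtain h g where g: "g \<in> set fs" "h \<in> set (insertion_row m f b)" "h \<in> set (insertion_row m g True)"
      by (auto simp: set_zigzag)
    from g(1) Cons.prems have "g \<in> rankings_on S" by auto
    then obtain l where l: "signed_ranking l g" "g m = 0"
      using Cons.prems(3) by (auto simp: rankings_on_def)
    from g obtain t u where "t \<in> slots k" "u \<in> slots l" "insert_at f m t = insert_at g m u"
      by (auto simp: set_row[OF k] set_row[OF l(1)])
    with insert_at_inj[OF k, OF fm _ l] have "f = g" by blast
    with g Cons.prems show False by simp
  qed
  then show ?case using Cons distinct_row[OF k, OF fm] by simp
qed simp

text \<open>Every row starts and ends with \<open>m\<close> as an additional outermost block, hence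
  one level above its source.\<close>

lemma zigzag_ends:
  assumes "fs \<noteq> []" "set fs \<subseteq> rankings_on S" "m \<notin> S" "signed_ranking k (hd fs)" "signed_ranking l (last fs)"
  shows "zigzag m b fs \<noteq> [] \<and> signed_ranking (k + 1) (hd (zigzag m b fs)) \<and>
    signed_ranking (l + 1) (last (zigzag m b fs))"
  using assms
proof (induction fs arbitrary: b k)
  case (Cons f fs)
  have k: "signed_ranking k f" using Cons.prems by simp
  have k0: "0 \<le> k" using k by (simp add: signed_ranking_def)
  have fm: "f m = 0" using Cons.prems by (auto simp: rankings_on_def)
  have ends: "signed_ranking (k + 1) (hd (insertion_row m f b))" "signed_ranking (k + 1) (last (insertion_row m f b))"
    using row_ends[OF k] k0 by (auto intro!: signed_ranking_upd_top[OF k, OF fm])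
  show ?case
  proof (cases "fs = []")
    case True
    with Cons.prems k have "l = k" using signed_ranking_unique by auto
    with True ends row_ends(1)[OF k] show ?thesis by simp
  next
    case False
    then have "hd fs \<in> rankings_on S" using Cons.prems by auto
    \<comment> \<open>The level of the new head may be anything; only the far end of the tail
      matters here.\<close>
    then obtain k' where "signed_ranking k' (hd fs)" by (auto simp: rankings_on_def)
    with Cons.IH[of k' "\<not> b"] Cons.prems False
    have "zigzag m (\<not> b) fs \<noteq> []" "signed_ranking (l + 1) (last (zigzag m (\<not> b) fs))"
      by auto
    with ends row_ends(1)[OF k] show ?thesis by simp
  qed
qed simp

lemma rankings_on_empty: "rankings_on {} = {\<lambda>_. 0}"
proof -
  have "signed_ranking 0 (\<lambda>_. 0)" by (auto simp: signed_ranking_def)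
  then show ?thesis by (auto simp: rankings_on_def)
qed

text \<open>The levels at both ends are carried through the induction: rankings with as many blocks
  as coordinates are the vertices, which later attach to the empty face.\<close>

lemma ex_hamiltonian_path_rankings_on:
  assumes "finite S"
  shows "\<exists>fs. fs \<noteq> [] \<and> distinct fs \<and> set fs = rankings_on S \<and> successively ranking_adj fs \<and>
    signed_ranking (int (card S)) (hd fs) \<and> signed_ranking (int (card S)) (last fs)"
  using assms
proof (induction S)
  case empty
  show ?case
    by (intro exI[of _ "[\<lambda>_. 0]"]) (auto simp: rankings_on_empty signed_ranking_def)
next
  case (insert m S)
  then obtain fs where fs: "fs \<noteq> []" "distinct fs" "set fs = rankings_on S"
    "successively ranking_adj fs" "signed_ranking (int (card S)) (hd fs)"
    "signed_ranking (int (card S)) (last fs)" by blast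
  have sub: "set fs \<subseteq> rankings_on S" using fs by simp
  have "int (card (insert m S)) = int (card S) + 1" using insert by simp
  then show ?case
    using zigzag_ends[OF fs(1) sub insert(2) fs(5,6), of True]
      distinct_zigzag[OF fs(2) sub insert(2)] set_zigzag_rankings_on[OF insert(2) fs(3)]
      zigzag_adj[OF fs(4) sub insert(2)]
    by (intro exI[of _ "zigzag m True fs"]) simp
qed

subsection \<open>Faces of the B-permutahedron\<close>

lemma refines_trans: "refines f g \<Longrightarrow> refines g h \<Longrightarrow> refines f h"
  unfolding refines_def by blast

text \<open>Signs and permutation can be read off a point again, so membership is a condition on
  absolute values alone.\<close>

lemma signed_permutation_points_iff:
  "x \<in> signed_permutation_points \<longleftrightarrow>
     bij_betw (\<lambda>i. \<bar>x $ i\<bar>) UNIV (real ` {1..CARD('n)})" for x :: "real ^ 'n"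
proof
  assume "x \<in> signed_permutation_points"
  then obtain \<sigma> \<pi> where x: "x = (\<chi> i. \<sigma> i * real (\<pi> i))"
    and \<pi>: "bij_betw \<pi> (UNIV :: 'n set) {1..CARD('n)}"
    and \<sigma>: "\<forall>i. \<sigma> i = 1 \<or> \<sigma> i = - 1"
    unfolding signed_permutation_points_def by blast
  have "\<bar>x $ i\<bar> = (real \<circ> \<pi>) i" for i using spec[OF \<sigma>, of i] by (auto simp: x)
  then have "(\<lambda>i. \<bar>x $ i\<bar>) = real \<circ> \<pi>" by blast
  moreover have "bij_betw real {1..CARD('n)} (real ` {1..CARD('n)})"
    by (simp add: bij_betw_def inj_on_def)
  ultimately show "bij_betw (\<lambda>i. \<bar>x $ i\<bar>) UNIV (real ` {1..CARD('n)})"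
    using bij_betw_trans[OF \<pi>] by metis
next
  assume b: "bij_betw (\<lambda>i. \<bar>x $ i\<bar>) UNIV (real ` {1..CARD('n)})"
  define \<pi> where "\<pi> i = nat \<lfloor>\<bar>x $ i\<bar>\<rfloor>" for i
  have nat: "bij_betw (\<lambda>r. nat \<lfloor>r\<rfloor>) (real ` {1..CARD('n)}) {1..CARD('n)}"
    by (rule bij_betw_byWitness[where f' = real]) auto
  have real: "real (\<pi> i) = \<bar>x $ i\<bar>" for i
  proof -
    obtain p where "\<bar>x $ i\<bar> = real p" using bij_betwE[OF b] by blast
    then show ?thesis by (simp add: \<pi>_def)
  qed
  have "bij_betw \<pi> UNIV {1..CARD('n)}"
    using bij_betw_trans[OF b nat] by (simp add: comp_def \<pi>_def[abs_def])
  moreover have "x = (\<chi> i. (if x $ i < 0 then -1 else 1) * real (\<pi> i))"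
    by (simp add: real vec_eq_iff)
  ultimately show "x \<in> signed_permutation_points"
    unfolding signed_permutation_points_def
    by (intro CollectI exI[of _ "\<lambda>i. if x $ i < 0 then -1 else 1"] exI[of _ \<pi>]) simp
qed

text \<open>Supplies the competitors in the exchange arguments; the signs of \<open>y\<close> are
  left free.\<close>

lemma signed_permutation_points_permute:
  fixes x y :: "real ^ 'n"
  assumes x: "x \<in> signed_permutation_points" and \<tau>: "bij \<tau>"
    and y: "\<And>i. \<bar>y $ i\<bar> = \<bar>x $ \<tau> i\<bar>"
  shows "y \<in> signed_permutation_points"
  using bij_betw_trans[OF \<tau> x[unfolded signed_permutation_points_iff]]
  by (simp add: signed_permutation_points_iff comp_def y)

lemma signed_permutation_points_nonzero:
  assumes "x \<in> signed_permutation_points"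
  shows "x $ i \<noteq> 0"
proof -
  have "\<bar>x $ i\<bar> \<in> real ` {1..CARD('a)}"
    using bij_betwE[OF assms[unfolded signed_permutation_points_iff]] by blast
  then show ?thesis by auto
qed

lemma signed_permutation_points_abs_eq:
  "x \<in> signed_permutation_points \<Longrightarrow> \<bar>x $ i\<bar> = \<bar>x $ j\<bar> \<longleftrightarrow> i = j"
  unfolding signed_permutation_points_iff bij_betw_def by (auto dest: injD)

lemma signed_permutation_points_nonempty: "signed_permutation_points \<noteq> ({} :: (real ^ 'n) set)"
proof -
  obtain \<pi> where \<pi>: "bij_betw \<pi> {1..CARD('n)} (UNIV :: 'n set)"
    using ex_bij_betw_nat_finite_1[OF finite_class.finite_UNIV] by blast
  let ?x = "(\<chi> i. real (inv_into {1..CARD('n)} \<pi> i)) :: real ^ 'n"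
  have "bij_betw real {1..CARD('n)} (real ` {1..CARD('n)})"
    by (simp add: bij_betw_def inj_on_def)
  from bij_betw_trans[OF bij_betw_inv_into[OF \<pi>] this]
  have "?x \<in> signed_permutation_points"
    by (simp add: signed_permutation_points_iff comp_def)
  then show ?thesis by blast
qed

section \<open>Vertices maximizing a linear functional\<close>

definition compatible_points :: "('n::finite \<Rightarrow> 'b::linordered_idom) \<Rightarrow> (real ^ 'n) set" where
  "compatible_points c = {x \<in> signed_permutation_points. refines (($) x) c}"

lemma compatible_points_mono: "refines f g \<Longrightarrow> compatible_points f \<subseteq> compatible_points g"
  unfolding compatible_points_def using refines_trans by blast

lemma compatible_points_inner:
  fixes c :: "real ^ 'n"
  assumes "x \<in> compatible_points (($) c)"
  shows "c \<bullet> x = (\<Sum>i\<in>UNIV. \<bar>c $ i\<bar> * \<bar>x $ i\<bar>)"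
proof -
  have "c $ i * x $ i = \<bar>c $ i\<bar> * \<bar>x $ i\<bar>" for i
    using assms by (cases "c $ i" "0 :: real" rule: linorder_cases)
      (auto simp: compatible_points_def refines_def)
  then show ?thesis by (simp add: inner_vec_def)
qed

text \<open>The coordinates of \<open>\<bar>c\<bar>\<close>, listed along the ranks of a compatible point, are sorted.\<close>

lemma compatible_points_sum:
  fixes c :: "real ^ 'n"
  assumes "x \<in> compatible_points (($) c)"
  shows "(\<Sum>i\<in>UNIV. \<bar>c $ i\<bar> * \<bar>x $ i\<bar>) =
    (\<Sum>r<CARD('n). sorted_list_of_multiset (image_mset (\<lambda>i. \<bar>c $ i\<bar>) (mset_set UNIV)) ! r * real (Suc r))"
proof -
  let ?n = "CARD('n)"
  have b: "bij_betw (\<lambda>i. \<bar>x $ i\<bar>) UNIV (real ` {1..?n})"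
    using assms by (simp add: compatible_points_def signed_permutation_points_iff)
  have "bij_betw (\<lambda>r. real (Suc r)) {..<?n} (real ` {1..?n})"
  proof -
    have "(\<lambda>r. real (Suc r)) ` {..<?n} = real ` Suc ` {..<?n}"
      by (simp add: image_image)
    also have "Suc ` {..<?n} = {1..?n}" by (simp add: image_Suc_lessThan)
    finally show ?thesis by (simp add: bij_betw_def inj_on_def)
  qed
  note bij_betw_trans[OF this bij_betw_inv_into[OF b]]
  \<comment> \<open>The coordinate at which \<open>\<bar>x\<bar>\<close> takes the value
    \<open>r + 1\<close>.\<close>
  moreover define \<rho> where "\<rho> = inv_into UNIV (\<lambda>i. \<bar>x $ i\<bar>) \<circ> (\<lambda>r. real (Suc r))"
  ultimately have \<rho>: "bij_betw \<rho> {..<?n} UNIV" by simp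
  have x\<rho>: "\<bar>x $ \<rho> r\<bar> = real (Suc r)" if "r < ?n" for r
  proof -
    have "real (Suc r) \<in> range (\<lambda>i. \<bar>x $ i\<bar>)"
      using b that by (simp add: bij_betw_def del: of_nat_Suc)
    then show ?thesis unfolding \<rho>_def comp_def by (rule f_inv_into_f)
  qed
  define L where "L = map (\<lambda>r. \<bar>c $ \<rho> r\<bar>) [0..<?n]"
  have "\<bar>c $ \<rho> r\<bar> \<le> \<bar>c $ \<rho> s\<bar>" if "r \<le> s" "s < ?n" for r s
  proof (rule ccontr)
    assume "\<not> ?thesis"
    then have "\<bar>x $ \<rho> s\<bar> < \<bar>x $ \<rho> r\<bar>"
      using assms by (simp add: compatible_points_def refines_def)
    then show False using x\<rho>[of r] x\<rho>[of s] that by simp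
  qed
  then have "sorted L" by (simp add: L_def sorted_iff_nth_mono)
  moreover have "mset L = image_mset (\<lambda>i. \<bar>c $ i\<bar>) (mset_set UNIV)"
  proof -
    have "mset L = image_mset (\<lambda>i. \<bar>c $ i\<bar>) (image_mset \<rho> (mset_set {..<?n}))"
      by (simp add: L_def image_mset.compositionality comp_def lessThan_atLeast0)
    also have "image_mset \<rho> (mset_set {..<?n}) = mset_set UNIV"
      using \<rho> by (simp add: image_mset_mset_set bij_betw_def)
    finally show ?thesis .
  qed
  \<comment> \<open>A sorted list is determined by its multiset, so \<open>L\<close> does not depend
    on \<open>x\<close>.\<close>
  ultimately have "sorted_list_of_multiset (image_mset (\<lambda>i. \<bar>c $ i\<bar>) (mset_set UNIV)) = L"
    by (metis sorted_list_of_multiset_mset sorted_sort_id)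
  moreover have "(\<Sum>i\<in>UNIV. \<bar>c $ i\<bar> * \<bar>x $ i\<bar>) = (\<Sum>r<?n. \<bar>c $ \<rho> r\<bar> * \<bar>x $ \<rho> r\<bar>)"
    using sum.reindex_bij_betw[OF \<rho>, of "\<lambda>i. \<bar>c $ i\<bar> * \<bar>x $ i\<bar>"] by simp
  ultimately show ?thesis using x\<rho> by (simp add: L_def)
qed

text \<open>An exchange argument: a wrong sign or a pair in the wrong order could be corrected, with
  a strict gain in the inner product.\<close>

lemma maximal_imp_compatible:
  fixes c :: "real ^ 'n"
  assumes x: "x \<in> signed_permutation_points"
    and max: "\<And>y. y \<in> signed_permutation_points \<Longrightarrow> c \<bullet> y \<le> c \<bullet> x"
  shows "x \<in> compatible_points (($) c)"
proof -
  have bound: "(\<Sum>i\<in>UNIV. \<bar>c $ i\<bar> * \<bar>x $ \<tau> i\<bar>) \<le> c \<bullet> x" if "bij \<tau>" for \<tau>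
  proof -
    \<comment> \<open>Signs are taken from \<open>c\<close>, so that no term of the inner product is
      negative.\<close>
    define y :: "real ^ 'n" where "y = (\<chi> i. (if c $ i < 0 then -1 else 1) * \<bar>x $ \<tau> i\<bar>)"
    have "y \<in> signed_permutation_points"
      by (rule signed_permutation_points_permute[OF x that]) (simp add: y_def)
    moreover have "c \<bullet> y = (\<Sum>i\<in>UNIV. \<bar>c $ i\<bar> * \<bar>x $ \<tau> i\<bar>)"
      by (auto simp: inner_vec_def y_def intro!: sum.cong)
    ultimately show ?thesis using max by metis
  qed
  have le: "c $ i * x $ i \<le> \<bar>c $ i\<bar> * \<bar>x $ i\<bar>" for i
    by (metis abs_ge_self abs_mult)
  have eq: "c $ i * x $ i = \<bar>c $ i\<bar> * \<bar>x $ i\<bar>" for i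
  proof (rule ccontr)
    assume "c $ i * x $ i \<noteq> \<bar>c $ i\<bar> * \<bar>x $ i\<bar>"
    with le[of i] have "c $ i * x $ i < \<bar>c $ i\<bar> * \<bar>x $ i\<bar>" by linarith
    then have "c \<bullet> x < (\<Sum>i\<in>UNIV. \<bar>c $ i\<bar> * \<bar>x $ i\<bar>)"
      unfolding inner_vec_def inner_real_def
      by (intro sum_strict_mono_ex1) (use le in auto)
    \<comment> \<open>The identity permutation only corrects signs.\<close>
    with bound[of id] show False by simp
  qed
  have "refines (($) x) (($) c)"
    unfolding refines_def
  proof (intro conjI allI impI)
    fix i j
    note nz = signed_permutation_points_nonzero[OF x, of i]
    have nn: "0 \<le> c $ i * x $ i" by (simp add: eq)
    show "0 < x $ i" if "0 < c $ i"
      using nn nz that by (simp add: zero_le_mult_iff)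
    show "x $ i < 0" if "c $ i < 0"
      using nn nz that by (simp add: zero_le_mult_iff)
    show "\<bar>x $ i\<bar> < \<bar>x $ j\<bar>" if less: "\<bar>c $ i\<bar> < \<bar>c $ j\<bar>"
    proof (rule ccontr)
      assume "\<not> ?thesis"
      moreover have ij: "i \<noteq> j" using less by auto
      ultimately have "\<bar>x $ j\<bar> < \<bar>x $ i\<bar>"
        using signed_permutation_points_abs_eq[OF x, of i j] by linarith
      \<comment> \<open>Expanding this product gives the gain from exchanging the two ranks, as in
        the rearrangement inequality.\<close>
      with less have "0 < (\<bar>c $ j\<bar> - \<bar>c $ i\<bar>) * (\<bar>x $ i\<bar> - \<bar>x $ j\<bar>)" by simp
      then have gain: "\<bar>c $ i\<bar> * \<bar>x $ i\<bar> + \<bar>c $ j\<bar> * \<bar>x $ j\<bar> < \<bar>c $ i\<bar> * \<bar>x $ j\<bar> + \<bar>c $ j\<bar> * \<bar>x $ i\<bar>"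
        by (simp add: algebra_simps)
      define \<tau> where "\<tau> = Transposition.transpose i j"
      have split: "(\<Sum>l\<in>UNIV. h l) = h i + h j + (\<Sum>l\<in>UNIV - {i, j}. h l)" for h :: "'n \<Rightarrow> real"
        using ij sum.subset_diff[of "{i, j}" UNIV h] by simp
      have "(\<Sum>l\<in>UNIV - {i, j}. \<bar>c $ l\<bar> * \<bar>x $ \<tau> l\<bar>) = (\<Sum>l\<in>UNIV - {i, j}. \<bar>c $ l\<bar> * \<bar>x $ l\<bar>)"
        by (intro sum.cong) (auto simp: \<tau>_def)
      then have "(\<Sum>l\<in>UNIV. \<bar>c $ l\<bar> * \<bar>x $ l\<bar>) < (\<Sum>l\<in>UNIV. \<bar>c $ l\<bar> * \<bar>x $ \<tau> l\<bar>)"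
        using gain by (simp add: split \<tau>_def)
      moreover have "c \<bullet> x = (\<Sum>l\<in>UNIV. \<bar>c $ l\<bar> * \<bar>x $ l\<bar>)" by (simp add: inner_vec_def eq)
      moreover have "bij \<tau>" by (simp add: \<tau>_def)
      ultimately show False using bound by fastforce
    qed
  qed
  with x show ?thesis by (simp add: compatible_points_def)
qed

text \<open>A maximizer among the finitely many points is compatible, and all compatible points
  share one value, the sorted sum; hence they are exactly the maximizers.\<close>

lemma compatible_points_maximal:
  fixes c :: "real ^ 'n"
  obtains b where "compatible_points (($) c) \<noteq> {}"
    and "\<forall>x\<in>signed_permutation_points. c \<bullet> x \<le> b"
    and "\<forall>x\<in>signed_permutation_points. c \<bullet> x = b \<longleftrightarrow> x \<in> compatible_points (($) c)"
proof -
  let ?V = "signed_permutation_points :: (real ^ 'n) set"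
  obtain w where w: "w \<in> ?V" "Max ((\<bullet>) c ` ?V) = c \<bullet> w"
    using obtains_MAX[OF finite_signed_permutation_points signed_permutation_points_nonempty] .
  then have max: "c \<bullet> y \<le> c \<bullet> w" if "y \<in> ?V" for y
    using that Max_ge[of "(\<bullet>) c ` ?V"] finite_signed_permutation_points by (metis finite_imageI imageI)
  with w(1) have cw: "w \<in> compatible_points (($) c)" by (intro maximal_imp_compatible)
  have "c \<bullet> x = c \<bullet> w \<longleftrightarrow> x \<in> compatible_points (($) c)" if x: "x \<in> signed_permutation_points" for x
  proof
    assume "c \<bullet> x = c \<bullet> w"
    with max x show "x \<in> compatible_points (($) c)" by (intro maximal_imp_compatible) auto
  next
    assume "x \<in> compatible_points (($) c)"
    with cw show "c \<bullet> x = c \<bullet> w"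
      by (simp add: compatible_points_inner compatible_points_sum)
  qed
  with max cw show ?thesis by (intro that[of "c \<bullet> w"]) auto
qed

section \<open>Faces as hulls of compatible vertices\<close>

lemma face_of_convex_hull_eq:
  fixes V :: "'a::euclidean_space set"
  assumes "finite V" "T face_of convex hull V"
  shows "T = convex hull (T \<inter> V)"
proof -
  obtain V' where V': "V' \<subseteq> V" "T = convex hull V'"
    by (rule face_of_convex_hull_subset[OF finite_imp_compact[OF assms(1)] assms(2)])
  have "V' \<subseteq> T" unfolding V'(2) by (rule hull_subset)
  with V'(1) have "V' \<subseteq> T \<inter> V" by simp
  then have "T \<subseteq> convex hull (T \<inter> V)" using V'(2) hull_mono by metis
  moreover have "convex hull (T \<inter> V) \<subseteq> T"
    using face_of_imp_convex[OF assms(2)] by (intro hull_minimal) auto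
  ultimately show ?thesis by blast
qed

text \<open>The hyperplane at the maximal value \<open>b\<close> supports the polytope, and the
  vertices on it are the compatible points.\<close>

lemma real_vector_compatible_hull:
  fixes c :: "real ^ 'n"
  defines "F \<equiv> convex hull compatible_points (($) c)"
  shows "F face_of B_permutahedron" "F \<inter> signed_permutation_points = compatible_points (($) c)"
    "F \<noteq> {}"
proof -
  obtain b where b: "compatible_points (($) c) \<noteq> {}"
    "\<forall>x\<in>signed_permutation_points. c \<bullet> x \<le> b"
    "\<forall>x\<in>signed_permutation_points. c \<bullet> x = b \<longleftrightarrow> x \<in> compatible_points (($) c)"
    by (rule compatible_points_maximal)
  let ?T = "B_permutahedron \<inter> {x. c \<bullet> x = b}"
  have "B_permutahedron \<subseteq> {x. c \<bullet> x \<le> b}"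
    unfolding B_permutahedron_def using b(2) by (intro hull_minimal) (auto simp: convex_halfspace_le)
  then have face: "?T face_of B_permutahedron"
    by (intro face_of_Int_supporting_hyperplane_le) (auto simp: B_permutahedron_def)
  have "signed_permutation_points \<subseteq> (B_permutahedron :: (real ^ 'n) set)"
    unfolding B_permutahedron_def by (rule hull_subset)
  then have TV: "?T \<inter> signed_permutation_points = compatible_points (($) c)"
    using b(3) by (auto simp: compatible_points_def)
  have "?T = convex hull (?T \<inter> signed_permutation_points)"
    using face unfolding B_permutahedron_def
    by (rule face_of_convex_hull_eq[OF finite_signed_permutation_points])
  also note TV
  finally have "?T = F" unfolding F_def .
  with face TV b(1) show "F face_of B_permutahedron" "F \<inter> signed_permutation_points = compatible_points (($) c)"
    "F \<noteq> {}" by auto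
qed

text \<open>Faces of a polyhedron are exposed, which provides the functional
  \<open>c\<close>.\<close>

lemma face_eq_compatible_hull:
  fixes F :: "(real ^ 'n) set"
  assumes F: "F face_of B_permutahedron" "F \<noteq> {}"
  obtains c :: "real ^ 'n" where "F = convex hull compatible_points (($) c)"
proof -
  have "F exposed_face_of B_permutahedron"
    using F(1) exposed_face_of_polyhedron[OF polytope_imp_polyhedron[OF polytope_B_permutahedron]]
    by blast
  then obtain c \<beta> where c: "B_permutahedron \<subseteq> {x. c \<bullet> x \<le> \<beta>}"
    and F': "F = B_permutahedron \<inter> {x. c \<bullet> x = \<beta>}"
    unfolding exposed_face_of_def by blast
  have FV: "F = convex hull (F \<inter> signed_permutation_points)"
    by (rule face_of_convex_hull_eq[OF finite_signed_permutation_points F(1)[unfolded B_permutahedron_def]])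
  with F(2) have "F \<inter> signed_permutation_points \<noteq> {}" by (metis convex_hull_eq_empty)
  then obtain w where w: "w \<in> F" "w \<in> signed_permutation_points" by blast
  have sub: "signed_permutation_points \<subseteq> (B_permutahedron :: (real ^ 'n) set)"
    unfolding B_permutahedron_def by (rule hull_subset)
  obtain b where b: "compatible_points (($) c) \<noteq> {}"
    "\<forall>x\<in>signed_permutation_points. c \<bullet> x \<le> b"
    "\<forall>x\<in>signed_permutation_points. c \<bullet> x = b \<longleftrightarrow> x \<in> compatible_points (($) c)"
    by (rule compatible_points_maximal)
  \<comment> \<open>A nonempty face contains a vertex, so the bound of the supporting hyperplane is
    attained at a vertex.\<close>
  have "b = \<beta>"
  proof (rule antisym)
    show "\<beta> \<le> b" using bspec[OF b(2) w(2)] w(1) F' by simp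
    obtain v where "v \<in> compatible_points (($) c)" using b(1) by blast
    then have "v \<in> signed_permutation_points" "c \<bullet> v = b"
      using b(3) by (auto simp: compatible_points_def)
    then show "b \<le> \<beta>" using c sub by blast
  qed
  note FV
  also have "F \<inter> signed_permutation_points = compatible_points (($) c)"
    unfolding F' using b(3) sub \<open>b = \<beta>\<close> by (auto simp: compatible_points_def)
  finally show ?thesis by (rule that)
qed

section \<open>Correspondence between nonempty faces and signed rankings\<close>

definition ranking_face :: "('n::finite \<Rightarrow> int) \<Rightarrow> (real ^ 'n) set" where
  "ranking_face f = convex hull compatible_points f"

text \<open>Casting preserves signs and order, which brings rankings under the results on
  functionals.\<close>

lemma compatible_points_real_vector:
  "compatible_points (($) (\<chi> i. real_of_int (f i))) = compatible_points f"
  unfolding compatible_points_def refines_def by (simp flip: of_int_abs)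

lemma ranking_face_properties:
  shows ranking_face_face_of: "ranking_face f face_of B_permutahedron"
    and ranking_face_vertices: "ranking_face f \<inter> signed_permutation_points = compatible_points f"
    and ranking_face_nonempty: "ranking_face f \<noteq> {}"
  unfolding ranking_face_def
  using real_vector_compatible_hull[of "\<chi> i. real_of_int (f i)"]
  unfolding compatible_points_real_vector by blast+

text \<open>Counting the elements up to a given one serves as a strictly monotone rank
  function.\<close>

lemma card_atMost_less_iff:
  fixes A :: "'a::linorder set"
  assumes "finite A" "a \<in> A" "b \<in> A"
  shows "card {x \<in> A. x \<le> a} < card {x \<in> A. x \<le> b} \<longleftrightarrow> a < b"
proof
  assume "card {x \<in> A. x \<le> a} < card {x \<in> A. x \<le> b}"
  show "a < b"
  proof (rule ccontr)
    assume "\<not> a < b"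
    then have "card {x \<in> A. x \<le> b} \<le> card {x \<in> A. x \<le> a}"
      using assms(1) by (intro card_mono) auto
    with \<open>card {x \<in> A. x \<le> a} < card {x \<in> A. x \<le> b}\<close> show False by simp
  qed
next
  assume "a < b"
  moreover have "b \<in> {x \<in> A. x \<le> b} - {x \<in> A. x \<le> a}" using assms(3) \<open>a < b\<close> by simp
  ultimately have "{x \<in> A. x \<le> a} \<subset> {x \<in> A. x \<le> b}" by fastforce
  then show "card {x \<in> A. x \<le> a} < card {x \<in> A. x \<le> b}"
    using assms(1) by (intro psubset_card_mono) auto
qed

lemma image_card_atMost:
  fixes A :: "'a::linorder set"
  assumes "finite A"
  shows "(\<lambda>a. card {x \<in> A. x \<le> a}) ` A = {1..card A}"
proof (rule card_subset_eq)
  have "card {x \<in> A. x \<le> a} \<in> {1..card A}" if "a \<in> A" for a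
  proof -
    have "card {a} \<le> card {x \<in> A. x \<le> a}" using assms that by (intro card_mono) auto
    moreover have "card {x \<in> A. x \<le> a} \<le> card A" using assms by (intro card_mono) auto
    ultimately show ?thesis by simp
  qed
  then show "(\<lambda>a. card {x \<in> A. x \<le> a}) ` A \<subseteq> {1..card A}" by blast
  have "inj_on (\<lambda>a. card {x \<in> A. x \<le> a}) A"
  proof (rule inj_onI)
    fix a b assume "a \<in> A" "b \<in> A" "card {x \<in> A. x \<le> a} = card {x \<in> A. x \<le> b}"
    with card_atMost_less_iff[OF assms, of a b] card_atMost_less_iff[OF assms, of b a]
    show "a = b" by (simp add: linorder_neq_iff)
  qed
  then show "card ((\<lambda>a. card {x \<in> A. x \<le> a}) ` A) = card {1..card A}"
    by (simp add: card_image)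
qed simp

text \<open>Each nonzero absolute value of \<open>c\<close> is replaced by its rank among the
  distinct ones, and signs are kept.\<close>

lemma ex_equivalent_signed_ranking:
  fixes c :: "'n::finite \<Rightarrow> real"
  obtains k f where "signed_ranking k f" "refines f c" "refines c f"
proof -
  \<comment> \<open>Without zero the ranks start at 1, and the zero coordinates of \<open>c\<close>
    form the zero block.\<close>
  define A where "A = (\<lambda>i. \<bar>c i\<bar>) ` UNIV - {0}"
  define r where "r a = card {x \<in> A. x \<le> a}" for a
  define f where "f i = (if c i = 0 then 0 else if 0 < c i then int (r \<bar>c i\<bar>) else - int (r \<bar>c i\<bar>))" for i
  have fin: "finite A" by (simp add: A_def)
  have rA: "r ` A = {1..card A}" unfolding r_def[abs_def] by (rule image_card_atMost[OF fin])
  have less: "r a < r b \<longleftrightarrow> a < b" if "a \<in> A" "b \<in> A" for a b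
    unfolding r_def by (rule card_atMost_less_iff[OF fin that])
  have inA: "\<bar>c i\<bar> \<in> A" if "c i \<noteq> 0" for i using that by (simp add: A_def)
  have pos: "1 \<le> r \<bar>c i\<bar>" "r \<bar>c i\<bar> \<le> card A" if "c i \<noteq> 0" for i
    using rA inA[OF that] by (metis atLeastAtMost_iff imageI)+
  have abs: "\<bar>f i\<bar> = (if c i = 0 then 0 else int (r \<bar>c i\<bar>))" for i by (simp add: f_def)
  have fless: "\<bar>f i\<bar> < \<bar>f j\<bar> \<longleftrightarrow> \<bar>c i\<bar> < \<bar>c j\<bar>" for i j
    using pos[of i] pos[of j] less[OF inA inA, of i j] by (auto simp: abs)
  show ?thesis
  proof (rule that)
    show "signed_ranking (int (card A)) f"
      unfolding signed_ranking_def
    proof (intro conjI allI impI)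
      show "\<bar>f i\<bar> \<le> int (card A)" for i using pos[of i] by (simp add: abs)
      fix x assume x: "1 \<le> x \<and> x \<le> int (card A)"
      then have "nat x \<in> r ` A" unfolding rA by auto
      then obtain a where a: "a \<in> A" "r a = nat x" by auto
      then obtain i where "\<bar>c i\<bar> = a" "c i \<noteq> 0" unfolding A_def by auto
      with a have "c i \<noteq> 0" "r \<bar>c i\<bar> = nat x" by simp_all
      with x show "\<exists>i. \<bar>f i\<bar> = x" by (intro exI[of _ i]) (simp add: abs)
    qed simp
    have sgn: "0 < f i \<longleftrightarrow> 0 < c i" "f i < 0 \<longleftrightarrow> c i < 0" for i
      using pos[of i] by (auto simp: f_def)
    show "refines f c" "refines c f" by (auto simp: refines_def fless sgn)
  qed
qed

lemma face_eq_ranking_face: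
  fixes F :: "(real ^ 'n) set"
  assumes "F face_of B_permutahedron" "F \<noteq> {}"
  obtains k f where "signed_ranking k f" "F = ranking_face f"
proof -
  obtain c :: "real ^ 'n" where c: "F = convex hull compatible_points (($) c)"
    using face_eq_compatible_hull[OF assms] .
  obtain k f where f: "signed_ranking k f" "refines f (($) c)" "refines (($) c) f"
    using ex_equivalent_signed_ranking .
  then have "compatible_points (($) c) = compatible_points f"
    by (intro equalityI compatible_points_mono)
  with c f(1) that show ?thesis by (simp add: ranking_face_def)
qed

text \<open>Modifying a point compatible with \<open>f\<close> where \<open>f\<close> imposes
  nothing keeps it compatible with \<open>f\<close>, hence with \<open>g\<close>; so
  \<open>g\<close> imposes nothing there either.\<close>

lemma compatible_points_subset_imp_refines:
  fixes f g :: "'n::finite \<Rightarrow> int"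
  assumes sub: "compatible_points f \<subseteq> compatible_points g"
  shows "refines f g"
proof -
  obtain x where x: "x \<in> compatible_points f"
    using ranking_face_nonempty[of f] by (auto simp: ranking_face_def)
  have xV: "x \<in> signed_permutation_points" using x by (simp add: compatible_points_def)
  have xf: "0 < f i \<Longrightarrow> 0 < x $ i" "f i < 0 \<Longrightarrow> x $ i < 0"
    "\<bar>f i\<bar> < \<bar>f j\<bar> \<Longrightarrow> \<bar>x $ i\<bar> < \<bar>x $ j\<bar>" for i j
    using x by (auto simp: compatible_points_def refines_def)
  have xg: "0 < g i \<Longrightarrow> 0 < y $ i" "g i < 0 \<Longrightarrow> y $ i < 0"
    "\<bar>g i\<bar> < \<bar>g j\<bar> \<Longrightarrow> \<bar>y $ i\<bar> < \<bar>y $ j\<bar>" if "y \<in> compatible_points f" for i j y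
    using sub that by (auto simp: compatible_points_def refines_def)
  have flip: "g i = 0" if "f i = 0" for i
  proof -
    \<comment> \<open>As \<open>f i = 0\<close> leaves the sign at \<open>i\<close> free, both signs
      occur among the compatible points.\<close>
    define y where "y = (\<chi> l. if l = i then - x $ l else x $ l)"
    have abs: "\<bar>y $ l\<bar> = \<bar>x $ l\<bar>" for l by (simp add: y_def)
    have "y \<in> signed_permutation_points"
      by (rule signed_permutation_points_permute[OF xV bij_id]) (simp add: abs)
    then have y: "y \<in> compatible_points f"
      using xf that by (auto simp: compatible_points_def refines_def abs) (auto simp: y_def)
    show ?thesis
      using xg(1,2)[OF x, of i] xg(1,2)[OF y, of i] by (simp add: y_def) linarith
  qed
  have swap: "\<bar>g i\<bar> = \<bar>g j\<bar>" if ij: "\<bar>f i\<bar> = \<bar>f j\<bar>" for i j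
  proof -
    define \<tau> where "\<tau> = Transposition.transpose i j"
    \<comment> \<open>The absolute values at two tied coordinates are exchanged, while the sign
      pattern of \<open>x\<close> is kept.\<close>
    define y where "y = (\<chi> l. if x $ l < 0 then - \<bar>x $ \<tau> l\<bar> else \<bar>x $ \<tau> l\<bar>)"
    have abs: "\<bar>y $ l\<bar> = \<bar>x $ \<tau> l\<bar>" for l by (simp add: y_def)
    have "bij \<tau>" by (simp add: \<tau>_def)
    then have yV: "y \<in> signed_permutation_points"
      by (rule signed_permutation_points_permute[OF xV]) (rule abs)
    have "\<bar>f (\<tau> l)\<bar> = \<bar>f l\<bar>" for l
      using ij by (auto simp: \<tau>_def Transposition.transpose_def)
    then have "\<bar>y $ l\<bar> < \<bar>y $ m\<bar>" if "\<bar>f l\<bar> < \<bar>f m\<bar>" for l m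
      using xf(3)[of "\<tau> l" "\<tau> m"] that by (simp add: abs)
    moreover have "0 < y $ l" if "0 < f l" for l
      using xf(1)[OF that] signed_permutation_points_nonzero[OF xV] by (simp add: y_def)
    moreover have "y $ l < 0" if "f l < 0" for l
      using xf(2)[OF that] signed_permutation_points_nonzero[OF xV] by (simp add: y_def)
    ultimately have y: "y \<in> compatible_points f"
      using yV by (simp add: compatible_points_def refines_def)
    show ?thesis
      using xg(3)[OF x, of i j] xg(3)[OF x, of j i] xg(3)[OF y, of i j] xg(3)[OF y, of j i]
      by (simp add: abs \<tau>_def) linarith
  qed
  \<comment> \<open>At \<open>x\<close>, a strict inequality for \<open>g\<close> excludes the
    opposite one for \<open>f\<close>; the flip and the swap exclude equality.\<close>
  show ?thesis
    unfolding refines_def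
  proof (intro conjI allI impI)
    fix i j
    show "0 < f i" if "0 < g i"
      using xg(1)[OF x that] xf(2)[of i] flip[of i] that by force
    show "f i < 0" if "g i < 0"
      using xg(2)[OF x that] xf(1)[of i] flip[of i] that by force
    show "\<bar>f i\<bar> < \<bar>f j\<bar>" if "\<bar>g i\<bar> < \<bar>g j\<bar>"
      using xg(3)[OF x that] xf(3)[of j i] swap[of i j] that by force
  qed
qed

text \<open>All ranks from 1 to \<open>\<bar>f i\<bar>\<close> are attained by \<open>f\<close>, so
  \<open>refines g f\<close> yields that many strict increases of \<open>\<bar>g\<bar>\<close>,
  starting from zero.\<close>

lemma signed_ranking_abs_le:
  fixes f g :: "'a \<Rightarrow> int"
  assumes f: "signed_ranking k f" and "refines f g" "refines g f"
  shows "\<bar>f i\<bar> \<le> \<bar>g i\<bar>"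
proof (induction "nat \<bar>f i\<bar>" arbitrary: i)
  case (Suc n)
  then have fi: "\<bar>f i\<bar> = int n + 1" by linarith
  show ?case
  proof (cases "n = 0")
    case True
    with fi have "0 < f i \<or> f i < 0" by linarith
    with assms(3) have "g i \<noteq> 0" unfolding refines_def by force
    with True fi show ?thesis by simp
  next
    case False
    moreover have "\<bar>f i\<bar> \<le> k" using f by (simp add: signed_ranking_def)
    ultimately have "1 \<le> int n \<and> int n \<le> k" using fi by linarith
    then obtain j where j: "\<bar>f j\<bar> = int n" using f unfolding signed_ranking_def by blast
    then have "int n \<le> \<bar>g j\<bar>" using Suc.hyps(1)[of j] by simp
    moreover have "\<bar>g j\<bar> < \<bar>g i\<bar>" using assms(3) j fi by (simp add: refines_def)
    ultimately show ?thesis using fi by linarith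
  qed
qed simp

text \<open>Absolute values without gaps make rankings canonical representatives of their
  equivalence classes.\<close>

lemma refines_antisym:
  assumes f: "signed_ranking k f" and g: "signed_ranking l g" and "refines f g" "refines g f"
  shows "f = g"
proof
  fix i
  have "\<bar>f i\<bar> = \<bar>g i\<bar>"
    using signed_ranking_abs_le[OF f assms(3,4)] signed_ranking_abs_le[OF g assms(4,3)] by (intro antisym)
  moreover have "0 < f i \<longleftrightarrow> 0 < g i" using assms(3,4) by (auto simp: refines_def)
  ultimately show "f i = g i" by linarith
qed

lemma ranking_face_mono_iff: "ranking_face f \<subseteq> ranking_face g \<longleftrightarrow> refines f g"
proof
  assume "ranking_face f \<subseteq> ranking_face g"
  then have "compatible_points f \<subseteq> compatible_points g"
    using ranking_face_vertices[of f] ranking_face_vertices[of g] by blast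
  then show "refines f g" by (rule compatible_points_subset_imp_refines)
qed (simp add: ranking_face_def hull_mono compatible_points_mono)

lemma ranking_face_inj:
  assumes "signed_ranking k f" "signed_ranking l g" "ranking_face f = ranking_face g"
  shows "f = g"
  using refines_antisym[OF assms(1,2)] ranking_face_mono_iff[of f g] ranking_face_mono_iff[of g f]
    assms(3) by simp

lemma split_cover_psubset:
  assumes "split_cover f g"
  shows "ranking_face f \<subset> ranking_face g"
proof -
  obtain k where k: "refines f g" "signed_ranking (k + 1) f" "signed_ranking k g"
    using assms unfolding split_cover_def by blast
  have "f \<noteq> g" using signed_ranking_unique[of "k + 1" f k] k by auto
  then have "ranking_face f \<noteq> ranking_face g" using ranking_face_inj k(2,3) by blast
  with k(1) show ?thesis using ranking_face_mono_iff by blast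
qed

section \<open>Dimension of the faces\<close>

lemma split_cover_aff_dim_less:
  assumes "split_cover f g"
  shows "aff_dim (ranking_face f) < aff_dim (ranking_face g)"
proof (rule face_of_aff_dim_lt)
  note sub = split_cover_psubset[OF assms]
  show "convex (ranking_face g)" by (simp add: ranking_face_def)
  show "ranking_face f face_of ranking_face g"
    using sub face_of_face[OF ranking_face_face_of] ranking_face_face_of by blast
  show "ranking_face f \<noteq> ranking_face g" using sub by blast
qed

text \<open>With fewer blocks than coordinates, either the zero block is nonempty or, by the
  pigeonhole principle, two coordinates share a block; in both cases one coordinate can be split
  off.\<close>

lemma ex_split_cover_below:
  fixes f :: "'n::finite \<Rightarrow> int"
  assumes f: "signed_ranking k f" and k: "k < int CARD('n)"
  obtains f' where "split_cover f' f" "signed_ranking (k + 1) f'"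
proof (cases "\<exists>i. f i = 0")
  case True
  then obtain i where i: "f i = 0" by blast
  \<comment> \<open>Reads \<open>f\<close> as the result of merging the singleton block 1 into the
    zero block.\<close>
  then have "f(i := 1 - sgn 1) = f" by auto
  moreover have "0 \<le> k" using f by (simp add: signed_ranking_def)
  ultimately show ?thesis
    using split_cover_insert_new_pred[OF f, of i 1] signed_ranking_insert_new[OF f, of i 1] i that
    by simp
next
  case False
  have "\<not> inj (\<lambda>i. \<bar>f i\<bar>)"
  proof
    assume "inj (\<lambda>i. \<bar>f i\<bar>)"
    moreover have "(\<lambda>i. \<bar>f i\<bar>) ` UNIV \<subseteq> {1..k}"
    proof
      fix x assume "x \<in> range (\<lambda>i. \<bar>f i\<bar>)"
      then obtain i where "x = \<bar>f i\<bar>" by blast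
      moreover have "f i \<noteq> 0" using False by blast
      moreover have "\<bar>f i\<bar> \<le> k" using f by (simp add: signed_ranking_def)
      ultimately show "x \<in> {1..k}" by simp
    qed
    ultimately have "CARD('n) \<le> card {1..k}" by (intro card_inj_on_le) auto
    moreover have "0 \<le> k" using f by (simp add: signed_ranking_def)
    ultimately show False using k by simp
  qed
  then obtain i j where ij: "\<bar>f i\<bar> = \<bar>f j\<bar>" "i \<noteq> j" by (auto simp: inj_def)
  \<comment> \<open>The rank of \<open>j\<close> survives at \<open>i\<close>, so \<open>f\<close>
    is the insertion of \<open>j\<close> into an existing block of \<open>g\<close>.\<close>
  define g where "g = f(j := 0)"
  have "\<exists>l. \<bar>g l\<bar> = x" if x: "1 \<le> x \<and> x \<le> k" for x
  proof -
    obtain l where "\<bar>f l\<bar> = x" using f x unfolding signed_ranking_def by blast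
    then show ?thesis using ij by (intro exI[of _ "if l = j then i else l"]) (auto simp: g_def)
  qed
  then have g: "signed_ranking k g" using f by (auto simp: signed_ranking_def g_def)
  have gj: "g j = 0" and fj: "f j \<noteq> 0" "\<bar>f j\<bar> \<le> k" and gf: "g(j := f j) = f"
    using False f by (auto simp: g_def signed_ranking_def)
  show ?thesis
    using split_cover_insert_new[OF g, OF gj fj] signed_ranking_insert_new[OF g, OF gj fj(1)] fj(2) that
    by (simp add: gf)
qed

text \<open>Moving every rank one step towards zero merges the innermost signed block into the zero
  block.\<close>

lemma ex_split_cover_above:
  assumes f: "signed_ranking (k + 1) f" and k: "0 \<le> k"
  obtains g where "split_cover f g" "signed_ranking k g"
proof -
  define g where "g i = f i - sgn (f i)" for i
  have abs: "\<bar>g i\<bar> = (if f i = 0 then 0 else \<bar>f i\<bar> - 1)" for i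
    using abs_diff_sgn[of "f i"] by (simp add: g_def)
  have g: "signed_ranking k g"
    unfolding signed_ranking_def
  proof (intro conjI allI impI)
    show "\<bar>g i\<bar> \<le> k" for i
    proof -
      have "\<bar>f i\<bar> \<le> k + 1" using f by (simp add: signed_ranking_def)
      with k show ?thesis unfolding abs by simp
    qed
    fix x assume x: "1 \<le> x \<and> x \<le> k"
    then have "1 \<le> x + 1 \<and> x + 1 \<le> k + 1" by linarith
    then obtain i where "\<bar>f i\<bar> = x + 1" using f unfolding signed_ranking_def by blast
    then have "\<bar>g i\<bar> = x" using x unfolding abs by auto
    then show "\<exists>i. \<bar>g i\<bar> = x" by blast
  qed (rule k)
  moreover have "refines f g"
  proof (rule refinesI_sgn)
    show "sgn (f i) = sgn (g i)" if "g i \<noteq> 0" for i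
      using that by (auto simp: g_def sgn_if split: if_splits)
    show "\<bar>f i\<bar> < \<bar>f j\<bar>" if "\<bar>g i\<bar> < \<bar>g j\<bar>" for i j
      using that unfolding abs by (auto split: if_splits)
  qed
  ultimately show ?thesis using f that by (auto simp: split_cover_def)
qed

lemma signed_ranking_le_card:
  fixes f :: "'n::finite \<Rightarrow> int"
  assumes "signed_ranking k f"
  shows "k \<le> int CARD('n)"
proof -
  have "{1..k} \<subseteq> (\<lambda>i. \<bar>f i\<bar>) ` UNIV" using assms by (force simp: signed_ranking_def)
  then have "card {1..k} \<le> CARD('n)" by (meson finite_class.finite_UNIV surj_card_le)
  then show ?thesis by simp
qed

text \<open>
  Every maximal chain of signed rankings has \<open>n + 1\<close> members, and dimensions strictly
  increase along it.
\<close>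

lemma aff_dim_ranking_face:
  fixes f :: "'n::finite \<Rightarrow> int"
  assumes "signed_ranking k f"
  shows "aff_dim (ranking_face f) = int CARD('n) - k"
proof (rule antisym)
  \<comment> \<open>Upper bound: \<open>m\<close> covers upwards, each raising the dimension, lead
    to a face of dimension at most \<open>n\<close>.\<close>
  have "aff_dim (ranking_face f) \<le> int CARD('n) - int m" if "signed_ranking (int m) f"
    for m and f :: "'n \<Rightarrow> int"
    using that
  proof (induction m arbitrary: f)
    case 0
    show ?case using aff_dim_le_DIM[of "ranking_face f"] by simp
  next
    case (Suc m)
    then have "signed_ranking (int m + 1) f" by (simp add: add.commute)
    then obtain g where "split_cover f g" "signed_ranking (int m) g"
      by (rule ex_split_cover_above) auto
    with Suc.IH[of g] split_cover_aff_dim_less[of f g] show ?case by simp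
  qed
  moreover have "0 \<le> k" using assms by (simp add: signed_ranking_def)
  ultimately show "aff_dim (ranking_face f) \<le> int CARD('n) - k"
    using assms by (metis nonneg_int_cases)
  \<comment> \<open>Lower bound: \<open>m\<close> covers downwards lead to a nonempty face, of
    dimension at least 0.\<close>
  have "int m \<le> aff_dim (ranking_face f)" if "signed_ranking (int CARD('n) - int m) f"
    for m and f :: "'n \<Rightarrow> int"
    using that
  proof (induction m arbitrary: f)
    case 0
    show ?case using ranking_face_nonempty[of f] aff_dim_geq[of "ranking_face f"] aff_dim_empty[of "ranking_face f"] by simp
  next
    case (Suc m)
    obtain g where "split_cover g f" "signed_ranking (int CARD('n) - int (Suc m) + 1) g"
      using Suc.prems by (rule ex_split_cover_below) auto
    with Suc.IH[of g] split_cover_aff_dim_less[of g f] show ?case by (simp add: algebra_simps)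
  qed
  from this[of "nat (int CARD('n) - k)" f] assms signed_ranking_le_card[OF assms]
  show "int CARD('n) - k \<le> aff_dim (ranking_face f)" by simp
qed

lemma split_cover_face_covers:
  assumes "split_cover f g"
  shows "(ranking_face f, ranking_face g) \<in> face_covers B_permutahedron"
proof -
  obtain k where "signed_ranking (k + 1) f" "signed_ranking k g"
    using assms unfolding split_cover_def by blast
  then show ?thesis
    using split_cover_psubset[OF assms]
    by (simp add: face_covers_def face_lattice_def aff_dim_ranking_face ranking_face_face_of)
qed

subsection \<open>The Hamiltonian cycle\<close>

lemma pcas_zip_tl: "vs \<noteq> [] \<Longrightarrow> pcas (hd vs) (zip vs (tl vs)) (last vs)"
proof (induction vs)
  case (Cons v vs)
  then show ?case by (cases vs) auto
qed simp

lemma pawalk_verts_zip_tl: "vs \<noteq> [] \<Longrightarrow> pawalk_verts (hd vs) (zip vs (tl vs)) = vs"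
proof (induction vs)
  case (Cons v vs)
  then show ?case by (cases vs) auto
qed simp

lemma set_zip_tl_subset:
  "successively (\<lambda>u v. (u, v) \<in> E) vs \<Longrightarrow> set (zip vs (tl vs)) \<subseteq> E"
proof (induction vs)
  case (Cons v vs)
  then show ?case by (cases vs) auto
qed simp

lemma hamiltonian_cycleI:
  assumes vs: "distinct vs" "set vs = pverts G" "3 \<le> length vs"
    and adj: "successively (\<lambda>u v. (u, v) \<in> parcs G) (vs @ [hd vs])"
  shows "hamiltonian_cycle G (zip vs (tl vs @ [hd vs]))"
proof -
  have ne: "vs \<noteq> []" using vs(3) by auto
  let ?ws = "vs @ [hd vs]" and ?p = "zip vs (tl vs @ [hd vs])"
  have len: "length (tl vs @ [hd vs]) = length vs" using ne by (simp add: Suc_leI)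
  \<comment> \<open>As \<open>zip\<close> stops at the shorter list, the closing vertex at the end
    of \<open>?ws\<close> occurs only as the head of an arc.\<close>
  have "zip (vs @ [v]) us = zip vs us" if "length us = length vs" for v us
    using that by (simp add: zip_append1)
  from this[OF len] have p: "zip ?ws (tl ?ws) = ?p" using ne by simp
  have "pcas (hd vs) ?p (hd vs)" "pawalk_verts (hd vs) ?p = ?ws"
    using pcas_zip_tl[of ?ws] pawalk_verts_zip_tl[of ?ws] ne by (simp_all only: p) simp_all
  moreover have "set ?p \<subseteq> parcs G" using set_zip_tl_subset[OF adj] by (simp only: p)
  moreover have "hd vs \<in> pverts G" using vs(2) ne hd_in_set by blast
  moreover have "distinct (tl ?ws)"
    using vs(1) ne by (cases vs) auto
  moreover have "map fst ?p = vs" using len by simp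
  then have "fst ` set ?p = pverts G" using vs(2) by (metis list.set_map)
  moreover have "length ?p = length vs" using len by simp
  moreover have "?p \<noteq> []" using calculation(6) ne by force
  ultimately show ?thesis
    using vs(3) unfolding hamiltonian_cycle_def pre_digraph.cycle_def pre_digraph.awalk_def
      cas_with_proj_eq awalk_verts_with_proj_eq with_proj_simps
    by metis
qed

theorem theorem8:
  shows "\<exists>p. hamiltonian_cycle (face_cover_graph (B_permutahedron :: (real ^ 'n::finite) set)) p"
proof -
  let ?P = "B_permutahedron :: (real ^ 'n) set"
  let ?n = "int CARD('n)"
  obtain fs :: "('n \<Rightarrow> int) list" where fs: "fs \<noteq> []" "distinct fs"
    "set fs = rankings_on UNIV" "successively ranking_adj fs"
    "signed_ranking ?n (hd fs)" "signed_ranking ?n (last fs)"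
    using ex_hamiltonian_path_rankings_on[of "UNIV :: 'n set"] by auto
  have ranked: "\<exists>k. signed_ranking k f" if "f \<in> set fs" for f
    using that fs(3) by (auto simp: rankings_on_def)
  define Fs where "Fs = map ranking_face fs"
  have Fs: "Fs \<noteq> []" "hd Fs = ranking_face (hd fs)" "last Fs = ranking_face (last fs)"
    using fs(1) by (simp_all add: Fs_def hd_map last_map)
  have "inj_on ranking_face (set fs)"
    using ranked ranking_face_inj by (meson inj_onI)
  then have "distinct ({} # Fs)"
    using fs(2) ranking_face_nonempty by (auto simp: Fs_def distinct_map)
  moreover have "set ({} # Fs) = pverts (face_cover_graph ?P)"
  proof -
    have "F \<in> ranking_face ` set fs" if F: "F face_of ?P" "F \<noteq> {}" for F
    proof -
      obtain k f where "signed_ranking k f" "F = ranking_face f"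
        using face_eq_ranking_face[OF F] .
      then show ?thesis by (auto simp: fs(3) rankings_on_def)
    qed
    then show ?thesis
      using ranking_face_face_of by (auto simp: Fs_def face_cover_graph_def face_lattice_def)
  qed
  moreover have "3 \<le> length ({} # Fs)"
  proof -
    \<comment> \<open>The zero ranking encodes the whole polytope. Since the number of coordinates
      is positive, it differs from the vertex at the start of the path, so there are at least two
      nonempty faces.\<close>
    have "signed_ranking 0 (\<lambda>_ :: 'n. 0)" by (auto simp: signed_ranking_def)
    then have "(\<lambda>_. 0) \<in> set fs" "hd fs \<noteq> (\<lambda>_. 0)"
      using fs(3) signed_ranking_unique[OF fs(5), of 0] by (auto simp: rankings_on_def)
    with fs(1) have "hd fs \<in> set fs" "card {hd fs, \<lambda>_. 0} = 2" by auto
    moreover have "card {hd fs, \<lambda>_. 0} \<le> card (set fs)"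
      using calculation(1) \<open>(\<lambda>_. 0) \<in> set fs\<close> by (intro card_mono) auto
    ultimately show ?thesis using distinct_card[OF fs(2)] by (simp add: Fs_def)
  qed
  moreover have "successively (\<lambda>F F'. (F, F') \<in> parcs (face_cover_graph ?P)) (({} # Fs) @ [hd ({} # Fs)])"
  proof -
    \<comment> \<open>Rankings of full level have faces of dimension 0, one more than the empty
      face, which therefore joins both ends of the path.\<close>
    have "({}, ranking_face f) \<in> face_covers ?P" if "signed_ranking ?n f" for f
      using that aff_dim_ranking_face[OF that] ranking_face_nonempty[of f]
      by (auto simp: face_covers_def face_lattice_def ranking_face_face_of)
    then have ends: "({}, hd Fs) \<in> face_covers ?P" "({}, last Fs) \<in> face_covers ?P"
      using fs(5,6) Fs by simp_all
    have "successively (\<lambda>F F'. (F, F') \<in> parcs (face_cover_graph ?P)) Fs"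
      unfolding Fs_def successively_map
      by (rule successively_mono[OF fs(4)])
        (auto simp: ranking_adj_def face_cover_graph_def intro: split_cover_face_covers)
    with ends Fs(1) show ?thesis
      by (simp add: successively_append_iff successively_Cons face_cover_graph_def)
  qed
  ultimately show ?thesis using hamiltonian_cycleI by blast
qed

end
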